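(* Let $L>0$, let $\Omega=(0,L)\subset\mathbb{R}$ be an interval in dimension $1$, and let $0<\alpha<2$. Let $\lambda_n(\alpha)$ denote the $n$-th eigenvalue of the fractional Laplacian $(-\Delta)^{\alpha/2}$ on $\Omega$. Then $$\lambda_n(\alpha) < \Big(\frac{n\pi}{L}\Big)^{\alpha}\qquad\text{for all } n=1,2,3,\ldots .$$
   Context: For $u\in L^2(\mathbb{R}^d)$ the Fourier transform is $\widehat{u}(\xi)=(2\pi)^{-d/2}\int_{\mathbb{R}^d}u(x)e^{-ix\cdot\xi}\,dx$. For $\alpha>0$, the fractional Laplacian $(-\Delta)^{\alpha/2}$ is the Fourier multiplier operator given by $\big((-\Delta)^{\alpha/2}u\big)\widehat{\ }(\xi)=|\xi|^\alpha\widehat{u}(\xi)$. For a bounded domain $\Omega\subset\mathbb{R}^d$, set $$H^{\alpha/2}_0(\Omega)=\{u\in H^{\alpha/2}(\mathbb{R}^d): u=0 \text{ a.e. on } \mathbb{R}^d\setminus\Omega\}.$$ The operator $(-\Delta)^{\alpha/2}$ on $\Omega$ is understood with this Dirichlet (exterior) condition; it has discrete spectrum with weak eigenfunctions in $H^{\alpha/2}_0(\Omega)$. Its eigenvalues, in nondecreasing order and counted with multiplicity, are $\lambda_1(\alpha)\le\lambda_2(\alpha)\le\cdots$, and they are characterized by $$\lambda_n(\alpha)=\min_{S}\max\Big\{\int_{\mathbb{R}^d}|\xi|^\alpha|\widehat{u}(\xi)|^2\,d\xi : u\in S,\ \int_{\mathbb{R}^d}|u|^2\,dx=1\Big\},$$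 where $S$ ranges over all $n$-dimensional subspaces of $H^{\alpha/2}_0(\Omega)$. Here $d=1$. *)

theory Defs
  imports "HOL-Analysis.Analysis"
begin

section \<open>The space of square-integrable functions on the line\<close>

text \<open>
  An element of the complex Hilbert space of square-integrable functions on the line is
  represented by a Borel function; two representatives are identified when they agree almost
  everywhere.
\<close>

definition square_integrable :: "(real \<Rightarrow> complex) \<Rightarrow> bool" where
  "square_integrable u \<longleftrightarrow>
     u \<in> borel_measurable lborel \<and> integrable lborel (\<lambda>x. (cmod (u x))\<^sup>2)"

definition L2_inner :: "(real \<Rightarrow> complex) \<Rightarrow> (real \<Rightarrow> complex) \<Rightarrow> complex" where
  "L2_inner u v = (LINT x|lborel. u x * cnj (v x))"

section \<open>The Fourier transform\<close>

definition truncated_fourier :: "real \<Rightarrow> (real \<Rightarrow> complex) \<Rightarrow> real \<Rightarrow> complex" where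
  "truncated_fourier R u \<xi> =
     (LINT x:{-R..R}|lborel. u x * exp (- (\<i> * complex_of_real (x * \<xi>)))) / sqrt (2 * pi)"

text \<open>
  For a general square-integrable \<open>u\<close> the integral defining the transform need not converge
  absolutely; as usual it is then read as the limit in the mean of the truncated integrals.
  If \<open>u\<close> vanishes almost everywhere outside a bounded set, the truncated integrals do not change
  any more once \<open>R\<close> is large, so that the transform is almost everywhere equal to the
  integral itself.
\<close>

definition is_fourier :: "(real \<Rightarrow> complex) \<Rightarrow> (real \<Rightarrow> complex) \<Rightarrow> bool" where
  "is_fourier u v \<longleftrightarrow> square_integrable v \<and>
     ((\<lambda>R. \<integral>\<^sup>+\<xi>. ennreal ((cmod (truncated_fourier R u \<xi> - v \<xi>))\<^sup>2) \<partial>lborel) \<longlongrightarrow> 0) at_top"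

text \<open>
  By Plancherel's theorem a function \<open>v\<close> as above exists for every square-integrable \<open>u\<close>. It is
  unique only up to a null set, which affects none of the integrals below.
\<close>

definition fourier :: "(real \<Rightarrow> complex) \<Rightarrow> real \<Rightarrow> complex" where
  "fourier u = (SOME v. is_fourier u v)"

section \<open>Sobolev spaces and the fractional Laplacian\<close>

definition sobolev :: "real \<Rightarrow> (real \<Rightarrow> complex) set" where
  "sobolev s = {u. square_integrable u \<and>
     integrable lborel (\<lambda>\<xi>. (1 + \<xi>\<^sup>2) powr s * (cmod (fourier u \<xi>))\<^sup>2)}"

definition sobolev0 :: "real set \<Rightarrow> real \<Rightarrow> (real \<Rightarrow> complex) set" where
  "sobolev0 \<Omega> s = {u \<in> sobolev s. AE x in lborel. x \<notin> \<Omega> \<longrightarrow> u x = 0}"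

text \<open>
  The sesquilinear form of the Fourier multiplier with symbol \<open>\<bar>\<xi>\<bar> powr \<alpha>\<close>.
\<close>

definition frac_form :: "real \<Rightarrow> (real \<Rightarrow> complex) \<Rightarrow> (real \<Rightarrow> complex) \<Rightarrow> complex" where
  "frac_form \<alpha> u v =
     (LINT \<xi>|lborel. complex_of_real (\<bar>\<xi>\<bar> powr \<alpha>) * (fourier u \<xi> * cnj (fourier v \<xi>)))"

definition weak_eigenfunction ::
  "real set \<Rightarrow> real \<Rightarrow> real \<Rightarrow> (real \<Rightarrow> complex) \<Rightarrow> bool" where
  "weak_eigenfunction \<Omega> \<alpha> \<mu> u \<longleftrightarrow>
     u \<in> sobolev0 \<Omega> (\<alpha> / 2) \<and> \<not> (AE x in lborel. u x = 0) \<and>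
     (\<forall>v \<in> sobolev0 \<Omega> (\<alpha> / 2). frac_form \<alpha> u v = complex_of_real \<mu> * L2_inner u v)"

text \<open>
  Linear independence over the complex numbers of the classes modulo almost everywhere equality of
  the functions \<open>u 0, \<dots>, u (n - 1)\<close>.
\<close>

definition AE_independent :: "nat \<Rightarrow> (nat \<Rightarrow> real \<Rightarrow> complex) \<Rightarrow> bool" where
  "AE_independent n u \<longleftrightarrow>
     (\<forall>c :: nat \<Rightarrow> complex. (AE x in lborel. (\<Sum>i<n. c i * u i x) = 0) \<longrightarrow> (\<forall>i<n. c i = 0))"

text \<open>
  At least \<open>n\<close> eigenvalues, counted with multiplicity, are at most \<open>t\<close>. The eigenvalues
  \<open>\<mu> i\<close> of the family need not be distinct. Since eigenspaces for different eigenvalues are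
  linearly independent, the largest possible size of such a family is the sum of the dimensions of
  the eigenspaces whose eigenvalue is at most \<open>t\<close>.
\<close>

definition eigenvalue_count_ge :: "real set \<Rightarrow> real \<Rightarrow> nat \<Rightarrow> real \<Rightarrow> bool" where
  "eigenvalue_count_ge \<Omega> \<alpha> n t \<longleftrightarrow>
     (\<exists>(\<mu> :: nat \<Rightarrow> real) (u :: nat \<Rightarrow> real \<Rightarrow> complex).
        (\<forall>i<n. weak_eigenfunction \<Omega> \<alpha> (\<mu> i) (u i) \<and> \<mu> i \<le> t) \<and> AE_independent n u)"

text \<open>
  The \<open>n\<close>-th term of the nondecreasing list, with multiplicity, of the eigenvalues, for
  \<open>n \<ge> 1\<close>. As the spectrum is discrete, the infimum is a minimum and an eigenvalue.
\<close>

definition frac_eigenvalue :: "real set \<Rightarrow> real \<Rightarrow> nat \<Rightarrow> real" where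
  "frac_eigenvalue \<Omega> \<alpha> n = Inf {t. eigenvalue_count_ge \<Omega> \<alpha> n t}"

end

theory Submission
  imports
    Defs
    "HOL-Probability.Characteristic_Functions"
    "HOL-Complex_Analysis.Great_Picard"
begin

text \<open>
The bound comes from the span of the first \<open>n\<close> Dirichlet sines \<open>sin (k * pi * x / L)\<close>, used as a
trial space for the fractional form. Put \<open>s = n * pi / L\<close>. On that span the Dirichlet integral, which
is the integral of \<open>\<xi>\<^sup>2\<close> against the squared modulus of the Fourier transform, is at most \<open>s\<^sup>2\<close> times the
squared norm. As \<open>\<alpha> / 2 < 1\<close>, the function \<open>t powr (\<alpha> / 2)\<close> is strictly concave and lies below its
tangent at \<open>t = 1\<close>; with \<open>t = \<xi>\<^sup>2 / s\<^sup>2\<close> this reads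
\<open>\<bar>\<xi>\<bar> powr \<alpha> \<le> s powr \<alpha> * (\<alpha> / 2 * (\<xi>\<^sup>2 / s\<^sup>2) + (1 - \<alpha> / 2))\<close>, with equality only at the two points
\<open>\<bar>\<xi>\<bar> = s\<close> (\<open>symbol_less_tangent\<close>). Integrating against the squared modulus of the transform shows that the
fractional form is strictly smaller than \<open>s powr \<alpha>\<close> times the squared norm on every nonzero trial
function (\<open>fractional_energy_less\<close>, \<open>sine_combination_energy\<close>).

The eigenvalues are listed through weak eigenfunctions, so the min-max principle has to be turned into
actual eigenfunctions. This is done by successive minimisation (\<open>eigenvectors_below\<close>): with \<open>k < n\<close>
orthonormal eigenfunctions at hand, the form is minimised over unit vectors orthogonal to them. Some
nonzero trial function is also orthogonal to them, whence the minimum is below \<open>s powr \<alpha>\<close>; and the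
minimiser is a new eigenfunction. The result is \<open>n\<close> orthonormal eigenfunctions whose eigenvalues are
all below \<open>s powr \<alpha>\<close>. The largest of these finitely many numbers is an upper bound for the \<open>n\<close>-th
eigenvalue, so that strictness survives without any uniformity on the trial space.

Minimisers exist because a sequence of bounded norm and bounded energy has a subsequence
converging in the mean (\<open>rellich\<close>), and because the energy is lower semicontinuous by Fatou's lemma.
The compactness is visible on the Fourier side: the transforms of functions supported in a fixed
interval are uniformly bounded and equi-Lipschitz, which gives a pointwise convergent subsequence, and
the energy bound makes the tails uniformly small. Plancherel's identity (\<open>plancherel\<close>) carries the
convergence back. For integrable bounded functions that are continuous almost everywhere it follows by
Gaussian summation; the general case is reached by approximation in the mean.
\<close>

section \<open>Hermitian forms on spaces of functions\<close>

text \<open>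
The forms are only positive semidefinite: functions that agree almost everywhere are not identified,
so that the inner product of square-integrable functions vanishes on the null functions.
\<close>

locale hermitian_form =
  fixes V :: "('a \<Rightarrow> complex) set"
    and B :: "('a \<Rightarrow> complex) \<Rightarrow> ('a \<Rightarrow> complex) \<Rightarrow> complex"
  assumes zero_mem: "(\<lambda>_. 0) \<in> V"
    and lin_mem: "u \<in> V \<Longrightarrow> v \<in> V \<Longrightarrow> (\<lambda>x. u x + c * v x) \<in> V"
    and left_lin: "u \<in> V \<Longrightarrow> v \<in> V \<Longrightarrow> w \<in> V \<Longrightarrow> B (\<lambda>x. u x + c * v x) w = B u w + c * B v w"
    and hermitian: "u \<in> V \<Longrightarrow> v \<in> V \<Longrightarrow> B v u = cnj (B u v)"
    and nonneg: "u \<in> V \<Longrightarrow> 0 \<le> Re (B u u)"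
begin

lemma diagonal_real: "u \<in> V \<Longrightarrow> B u u = of_real (Re (B u u))"
  using hermitian[of u u] by (simp add: complex_eq_iff)

lemma right_lin:
  assumes "u \<in> V" "v \<in> V" "w \<in> V"
  shows "B w (\<lambda>x. u x + c * v x) = B w u + cnj c * B w v"
proof -
  have "B w (\<lambda>x. u x + c * v x) = cnj (B (\<lambda>x. u x + c * v x) w)"
    by (intro hermitian lin_mem assms)
  also have "\<dots> = cnj (B u w) + cnj c * cnj (B v w)"
    by (simp add: left_lin assms)
  finally show ?thesis
    using hermitian[of u w] hermitian[of v w] assms by simp
qed

lemma sum_mem:
  fixes n :: nat
  assumes "\<And>i. i < n \<Longrightarrow> u i \<in> V"
  shows "(\<lambda>x. \<Sum>i<n. c i * u i x) \<in> V"
  using assms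
proof (induction n)
  case 0
  then show ?case using zero_mem by simp
next
  case (Suc n)
  then show ?case using lin_mem[of "\<lambda>x. \<Sum>i<n. c i * u i x" "u n" "c n"] by simp
qed

lemma zero_left: "w \<in> V \<Longrightarrow> B (\<lambda>_. 0) w = 0"
  using left_lin[OF zero_mem zero_mem, of w 1] by simp

lemma sum_left:
  fixes n :: nat
  assumes "\<And>i. i < n \<Longrightarrow> u i \<in> V" "w \<in> V"
  shows "B (\<lambda>x. \<Sum>i<n. c i * u i x) w = (\<Sum>i<n. c i * B (u i) w)"
  using assms
proof (induction n)
  case 0
  then show ?case using zero_left by simp
next
  case (Suc n)
  then show ?case
    using left_lin[of "\<lambda>x. \<Sum>i<n. c i * u i x" "u n" w "c n"] sum_mem[of n u c] by simp
qed

lemma sum_right: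
  fixes n :: nat
  assumes "\<And>i. i < n \<Longrightarrow> u i \<in> V" "w \<in> V"
  shows "B w (\<lambda>x. \<Sum>i<n. c i * u i x) = (\<Sum>i<n. cnj (c i) * B w (u i))"
proof -
  have "B w (\<lambda>x. \<Sum>i<n. c i * u i x) = cnj (B (\<lambda>x. \<Sum>i<n. c i * u i x) w)"
    by (intro hermitian sum_mem assms) auto
  also have "\<dots> = (\<Sum>i<n. cnj (c i) * cnj (B (u i) w))"
    using assms by (simp add: sum_left)
  also have "\<dots> = (\<Sum>i<n. cnj (c i) * B w (u i))"
    using assms hermitian[of "u _" w] by (intro sum.cong) auto
  finally show ?thesis .
qed

lemma diagonal_expand:
  assumes "u \<in> V" "v \<in> V"
  shows "Re (B (\<lambda>x. u x + c * v x) (\<lambda>x. u x + c * v x))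
    = Re (B u u) + 2 * Re (c * B v u) + (cmod c)\<^sup>2 * Re (B v v)"
proof -
  have "Re (B (\<lambda>x. u x + c * v x) (\<lambda>x. u x + c * v x))
      = Re (B u u + cnj c * B u v + c * (B v u + cnj c * B v v))"
    using assms by (simp add: left_lin right_lin lin_mem)
  also have "cnj c * B u v = cnj (c * B v u)"
    using hermitian[of v u] assms by simp
  also have "Re (B u u + cnj (c * B v u) + c * (B v u + cnj c * B v v))
      = Re (B u u) + 2 * Re (c * B v u) + Re ((c * cnj c) * B v v)"
    by (simp add: algebra_simps)
  also have "(c * cnj c) * B v v = of_real ((cmod c)\<^sup>2) * B v v"
    by (simp only: complex_norm_square)
  finally show ?thesis by (simp del: of_real_power)
qed

lemma cauchy_schwarz:
  assumes u: "u \<in> V" and v: "v \<in> V"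
  shows "(cmod (B u v))\<^sup>2 \<le> Re (B u u) * Re (B v v)"
proof -
  \<comment> \<open>Nonnegativity of the form at \<open>u - t * B u v * v\<close> for real \<open>t\<close>; the case \<open>b = 0\<close> is degenerate.\<close>
  define a where "a = (cmod (B u v))\<^sup>2"
  define b where "b = Re (B v v)"
  have *: "0 \<le> Re (B u u) - 2 * t * a + t\<^sup>2 * a * b" for t
  proof -
    have "complex_of_real (- t) * B u v * B v u = of_real (- t * a)"
      using hermitian[OF u v] by (simp add: a_def complex_norm_square[symmetric] mult.assoc del: of_real_power)
    then have "Re (complex_of_real (- t) * B u v * B v u) = - t * a"
      by (simp only: Re_complex_of_real)
    moreover have "(cmod (complex_of_real (- t) * B u v))\<^sup>2 = t\<^sup>2 * a"
      by (simp add: a_def norm_mult power_mult_distrib)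
    ultimately show ?thesis
      using nonneg[OF lin_mem[OF u v, of "complex_of_real (- t) * B u v"]]
        diagonal_expand[OF u v, of "complex_of_real (- t) * B u v"]
      by (simp only: b_def)
  qed
  show ?thesis
  proof (cases "b = 0")
    case True
    have "a = 0"
    proof (rule ccontr)
      assume "a \<noteq> 0"
      then show False
        using *[of "(Re (B u u) + 1) / (2 * a)"] True by (simp add: field_simps)
    qed
    then show ?thesis using True by (simp add: a_def b_def)
  next
    case False
    then have "b > 0" using nonneg[OF v] by (simp add: b_def)
    then have "a \<le> Re (B u u) * b"
      using *[of "1 / b"] by (simp add: field_simps power2_eq_square)
    then show ?thesis by (simp add: a_def b_def)
  qed
qed

lemma diff_mem: "u \<in> V \<Longrightarrow> v \<in> V \<Longrightarrow> (\<lambda>x. u x - v x) \<in> V"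
  using lin_mem[of u v "-1"] by simp

lemma left_diff: "u \<in> V \<Longrightarrow> v \<in> V \<Longrightarrow> w \<in> V \<Longrightarrow> B (\<lambda>x. u x - v x) w = B u w - B v w"
  using left_lin[of u v w "-1"] by simp

lemma tendsto_left:
  assumes "\<And>i. f i \<in> V" "u \<in> V" "v \<in> V"
    and lim: "((\<lambda>i. Re (B (\<lambda>x. f i x - u x) (\<lambda>x. f i x - u x))) \<longlongrightarrow> 0) F"
  shows "((\<lambda>i. B (f i) v) \<longlongrightarrow> B u v) F"
proof -
  define d where "d i = (\<lambda>x. f i x - u x)" for i
  have dV: "d i \<in> V" for i unfolding d_def by (intro diff_mem assms)
  have "((\<lambda>i. sqrt (Re (B (d i) (d i)) * Re (B v v))) \<longlongrightarrow> sqrt 0) F"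
    unfolding d_def by (rule tendsto_real_sqrt[OF tendsto_mult_left_zero[OF lim]])
  moreover have "cmod (B (d i) v) \<le> sqrt (Re (B (d i) (d i)) * Re (B v v))" for i
    using cauchy_schwarz[OF dV assms(3)] by (rule real_le_rsqrt)
  ultimately have "((\<lambda>i. B (d i) v) \<longlongrightarrow> 0) F"
    by (intro Lim_null_comparison[of "\<lambda>i. B (d i) v"]) auto
  then have "((\<lambda>i. B (d i) v + B u v) \<longlongrightarrow> 0 + B u v) F"
    by (rule tendsto_add[OF _ tendsto_const])
  then show ?thesis using assms by (simp add: d_def left_diff)
qed

lemma tendsto_diagonal:
  assumes "\<And>i. f i \<in> V" "u \<in> V"
    and lim: "((\<lambda>i. Re (B (\<lambda>x. f i x - u x) (\<lambda>x. f i x - u x))) \<longlongrightarrow> 0) F"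
  shows "((\<lambda>i. Re (B (f i) (f i))) \<longlongrightarrow> Re (B u u)) F"
proof -
  define d where "d i = (\<lambda>x. f i x - u x)" for i
  have dV: "d i \<in> V" for i unfolding d_def by (intro diff_mem assms)
  have du: "B (d i) u = B (f i) u - B u u" for i unfolding d_def by (intro left_diff assms)
  have "Re (B (f i) (f i)) = Re (B u u) + 2 * Re (B (f i) u - B u u) + Re (B (d i) (d i))" for i
    using diagonal_expand[OF assms(2) dV, of 1 i] du[of i] by (simp add: d_def)
  moreover have "((\<lambda>i. Re (B u u) + 2 * Re (B (f i) u - B u u) + Re (B (d i) (d i)))
      \<longlongrightarrow> Re (B u u) + 2 * Re (B u u - B u u) + 0) F"
    by (intro tendsto_add[OF _ lim[folded d_def]] tendsto_intros tendsto_left[OF assms(1,2,2) lim])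
  ultimately show ?thesis by simp
qed

lemma diagonal_diff_le:
  assumes "u \<in> V" "v \<in> V"
  shows "Re (B (\<lambda>x. u x - v x) (\<lambda>x. u x - v x)) \<le> 2 * Re (B u u) + 2 * Re (B v v)"
  using diagonal_expand[OF assms, of 1] diagonal_expand[OF assms, of "-1"] nonneg[OF lin_mem[OF assms, of 1]]
  by simp

lemma diagonal_orthogonal_sum:
  fixes n :: nat
  assumes u: "\<And>i. i < n \<Longrightarrow> u i \<in> V"
    and orth: "\<And>i j. i < n \<Longrightarrow> j < n \<Longrightarrow> B (u i) (u j) = (if i = j then of_real (d i) else 0)"
  shows "Re (B (\<lambda>x. \<Sum>i<n. c i * u i x) (\<lambda>x. \<Sum>i<n. c i * u i x)) = (\<Sum>i<n. (cmod (c i))\<^sup>2 * d i)"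
proof -
  have "B (\<lambda>x. \<Sum>i<n. c i * u i x) (\<lambda>x. \<Sum>i<n. c i * u i x) = (\<Sum>i<n. c i * (\<Sum>j<n. cnj (c j) * B (u i) (u j)))"
    using sum_left[OF u sum_mem[OF u]] sum_right[OF u] u by simp
  also have "\<dots> = (\<Sum>i<n. of_real ((cmod (c i))\<^sup>2 * d i))"
  proof (rule sum.cong)
    fix i assume "i \<in> {..<n}"
    then have "(\<Sum>j<n. cnj (c j) * B (u i) (u j)) = (\<Sum>j<n. if i = j then cnj (c j) * of_real (d j) else 0)"
      using orth by (intro sum.cong) auto
    also have "\<dots> = cnj (c i) * of_real (d i)" using \<open>i \<in> {..<n}\<close> by simp
    finally have "c i * (\<Sum>j<n. cnj (c j) * B (u i) (u j)) = (c i * cnj (c i)) * of_real (d i)" by (simp only: mult.assoc)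
    then show "c i * (\<Sum>j<n. cnj (c j) * B (u i) (u j)) = of_real ((cmod (c i))\<^sup>2 * d i)"
      by (simp only: complex_norm_square of_real_mult)
  qed simp
  finally show ?thesis by (simp only: of_real_sum[symmetric] Re_complex_of_real)
qed

end

section \<open>Eigenvectors by successive minimisation\<close>

text \<open>
Gaussian elimination of one unknown and one equation. This is what makes the trial space meet the
orthogonal complement of fewer vectors.
\<close>

lemma homogeneous_system_nontrivial:
  fixes A :: "nat \<Rightarrow> nat \<Rightarrow> 'b::field"
  assumes "k < n"
  shows "\<exists>c. (\<exists>i<n. c i \<noteq> 0) \<and> (\<forall>j<k. (\<Sum>i<n. c i * A i j) = 0)"
  using assms
proof (induction k arbitrary: n A)
  case 0
  then show ?case by (intro exI[of _ "\<lambda>_. 1"]) auto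
next
  case (Suc k)
  then obtain m where m: "n = Suc m" "k < m" by (cases n) auto
  show ?case
  proof (cases "\<forall>i<n. A i k = 0")
    case True
    obtain c where "\<exists>i<n. c i \<noteq> 0" "\<forall>j<k. (\<Sum>i<n. c i * A i j) = 0"
      using Suc.IH[of n A] Suc.prems by auto
    with True show ?thesis
      by (intro exI[of _ c]) (auto simp: less_Suc_eq)
  next
    case False
    then obtain p where p: "p < n" "A p k \<noteq> 0" by auto
    \<comment> \<open>\<open>\<sigma>\<close> enumerates the unknowns other than the pivot \<open>p\<close>, and \<open>\<tau>\<close> undoes it.\<close>
    define \<sigma> where "\<sigma> i = (if i < p then i else Suc i)" for i
    have bij: "bij_betw \<sigma> {..<m} ({..<n} - {p})"
      by (rule bij_betwI[where g = "\<lambda>i. if i < p then i else i - 1"])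
        (use p m in \<open>auto simp: \<sigma>_def split: if_splits\<close>)
    obtain d where d: "\<exists>i<m. d i \<noteq> 0"
      "\<forall>j<k. (\<Sum>i<m. d i * (A (\<sigma> i) j - A (\<sigma> i) k / A p k * A p j)) = 0"
      using Suc.IH[OF m(2), of "\<lambda>i j. A (\<sigma> i) j - A (\<sigma> i) k / A p k * A p j"] by auto
    define \<tau> where "\<tau> i = (if i < p then i else i - 1)" for i
    have \<tau>\<sigma>: "\<tau> (\<sigma> i) = i" for i by (auto simp: \<tau>_def \<sigma>_def)
    define c where "c i = (if i = p then - (\<Sum>l<m. d l * A (\<sigma> l) k) / A p k else d (\<tau> i))" for i
    have \<sigma>p: "\<sigma> i \<noteq> p" for i by (auto simp: \<sigma>_def)
    have sum_c: "(\<Sum>i<n. c i * A i j) = c p * A p j + (\<Sum>l<m. d l * A (\<sigma> l) j)" for j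
    proof -
      have "(\<Sum>i<n. c i * A i j) = c p * A p j + (\<Sum>i\<in>{..<n} - {p}. c i * A i j)"
        using p by (subst sum.remove[of _ p]) auto
      also have "(\<Sum>i\<in>{..<n} - {p}. c i * A i j) = (\<Sum>l<m. c (\<sigma> l) * A (\<sigma> l) j)"
        by (rule sum.reindex_bij_betw[OF bij, symmetric])
      finally show ?thesis using \<sigma>p by (simp add: c_def \<tau>\<sigma>)
    qed
    have "(\<Sum>i<n. c i * A i j) = 0" if "j < Suc k" for j
    proof (cases "j = k")
      case True
      then show ?thesis using p by (simp add: sum_c) (simp add: c_def)
    next
      case False
      then have "j < k" using that by simp
      with d(2) have "(\<Sum>i<m. d i * (A (\<sigma> i) j - A (\<sigma> i) k / A p k * A p j)) = 0" by blast
      moreover have "(\<Sum>i<m. d i * (A (\<sigma> i) j - A (\<sigma> i) k / A p k * A p j))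
        = (\<Sum>l<m. d l * A (\<sigma> l) j) - (\<Sum>l<m. d l * A (\<sigma> l) k) / A p k * A p j"
        by (simp add: algebra_simps sum_subtractf sum_distrib_left sum_divide_distrib)
      ultimately show ?thesis by (simp add: sum_c) (simp add: c_def)
    qed
    moreover have "\<exists>i<n. c i \<noteq> 0"
    proof -
      from d(1) obtain i where i: "i < m" "d i \<noteq> 0" by auto
      then have "\<sigma> i < n" using m by (auto simp: \<sigma>_def)
      moreover have "c (\<sigma> i) \<noteq> 0" using i \<sigma>p by (simp add: c_def \<tau>\<sigma>)
      ultimately show ?thesis by blast
    qed
    ultimately show ?thesis by blast
  qed
qed

text \<open>
The assumption combines two facts in the form in which a minimising sequence uses them: the
embedding of the form domain is compact, and the energy is lower semicontinuous along the limit.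
\<close>

locale compact_form_pair =
  ip: hermitian_form V ip + en: hermitian_form V Q for V :: "('a \<Rightarrow> complex) set" and ip Q +
  assumes compactness:
    "\<And>f m. (\<And>k::nat. f k \<in> V) \<Longrightarrow> (\<And>k. Re (ip (f k) (f k)) = 1)
      \<Longrightarrow> (\<lambda>k. Re (Q (f k) (f k))) \<longlonglongrightarrow> m
      \<Longrightarrow> \<exists>u\<in>V. \<exists>r::nat \<Rightarrow> nat. strict_mono r
          \<and> (\<lambda>k. Re (ip (\<lambda>x. f (r k) x - u x) (\<lambda>x. f (r k) x - u x))) \<longlonglongrightarrow> 0
          \<and> Re (Q u u) \<le> m"
begin

text \<open>
The direct method. A minimising sequence of unit vectors has a limit by compactness; orthogonality
and normalisation pass to the limit because convergence is in the norm of \<open>ip\<close>, and the energy of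
the limit does not exceed the infimum.
\<close>

lemma minimizer_exists:
  fixes k :: nat
  assumes e: "\<And>j. j < k \<Longrightarrow> e j \<in> V"
    and w: "w \<in> V" "\<And>j. j < k \<Longrightarrow> ip w (e j) = 0" "0 < Re (ip w w)"
  shows "\<exists>u\<in>V. (\<forall>j<k. ip u (e j) = 0) \<and> Re (ip u u) = 1 \<and>
    (\<forall>v\<in>V. (\<forall>j<k. ip v (e j) = 0) \<longrightarrow> Re (Q u u) * Re (ip v v) \<le> Re (Q v v))"
proof -
  define W where "W = {v \<in> V. \<forall>j<k. ip v (e j) = 0}"
  define m where "m = (INF v\<in>{v \<in> W. Re (ip v v) = 1}. Re (Q v v))"
  \<comment> \<open>Adding the zero function puts the rescaled vector into the shape \<open>u + c * v\<close> of the axioms.\<close>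
  define nrm where "nrm v = (\<lambda>x. 0 + complex_of_real (inverse (sqrt (Re (ip v v)))) * v x)" for v :: "'a \<Rightarrow> complex"
  have nrm: "nrm v \<in> W" "Re (ip (nrm v) (nrm v)) = 1" "Re (Q (nrm v) (nrm v)) = Re (Q v v) / Re (ip v v)"
    if v: "v \<in> W" "0 < Re (ip v v)" for v
  proof -
    have vV: "v \<in> V" using v by (simp add: W_def)
    have 0: "ip v (\<lambda>x. 0) = 0" "Q v (\<lambda>x. 0) = 0"
      using ip.zero_left[OF vV] ip.hermitian[OF ip.zero_mem vV] en.zero_left[OF vV] en.hermitian[OF ip.zero_mem vV] by auto
    show "nrm v \<in> W"
      using v ip.lin_mem[OF ip.zero_mem vV] ip.left_lin[OF ip.zero_mem vV e] ip.zero_left[OF e]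
      by (auto simp: W_def nrm_def simp del: of_real_inverse)
    show "Re (ip (nrm v) (nrm v)) = 1"
      unfolding nrm_def ip.diagonal_expand[OF ip.zero_mem vV]
      using v ip.zero_left[OF ip.zero_mem] 0 by (simp add: norm_inverse power_inverse divide_inverse mult.commute)
    show "Re (Q (nrm v) (nrm v)) = Re (Q v v) / Re (ip v v)"
      unfolding nrm_def en.diagonal_expand[OF ip.zero_mem vV]
      using v en.zero_left[OF ip.zero_mem] 0 by (simp add: norm_inverse power_inverse divide_inverse mult.commute)
  qed
  have bdd: "bdd_below ((\<lambda>v. Re (Q v v)) ` {v \<in> W. Re (ip v v) = 1})"
    by (rule bdd_belowI[of _ 0]) (auto simp: W_def intro: en.nonneg)
  have wW: "w \<in> W" using w by (simp add: W_def)
  then have ne: "{v \<in> W. Re (ip v v) = 1} \<noteq> {}"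
    using nrm[OF wW w(3)] by blast
  have m_le: "m * Re (ip v v) \<le> Re (Q v v)" if v: "v \<in> W" for v
  proof (cases "0 < Re (ip v v)")
    case True
    then have "m \<le> Re (Q v v) / Re (ip v v)"
      unfolding m_def nrm(3)[OF v True, symmetric]
      using nrm(1,2)[OF v True] by (intro cINF_lower bdd) auto
    then show ?thesis using True by (simp add: field_simps)
  next
    case False
    then have "Re (ip v v) = 0" using ip.nonneg[of v] v by (force simp: W_def)
    then show ?thesis using en.nonneg[of v] v by (simp add: W_def)
  qed
  have "\<exists>v. v \<in> W \<and> Re (ip v v) = 1 \<and> Re (Q v v) < m + 1 / Suc i" for i :: nat
  proof -
    have "m < m + 1 / Suc i" by simp
    then show ?thesis
      using cINF_less_iff[OF ne bdd, of "m + 1 / Suc i"] unfolding m_def by auto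
  qed
  then obtain f where f: "\<And>i. f i \<in> W" "\<And>i. Re (ip (f i) (f i)) = 1" "\<And>i. Re (Q (f i) (f i)) < m + 1 / Suc i"
    by metis
  have fV: "f i \<in> V" for i using f(1)[of i] by (simp add: W_def)
  have fm: "(\<lambda>i. Re (Q (f i) (f i))) \<longlonglongrightarrow> m"
  proof (rule tendsto_sandwich[of "\<lambda>_. m" _ _ "\<lambda>i. m + 1 / Suc i"])
    show "\<forall>\<^sub>F i in sequentially. m \<le> Re (Q (f i) (f i))"
      using m_le[OF f(1)] f(2) by (intro always_eventually) auto
    show "\<forall>\<^sub>F i in sequentially. Re (Q (f i) (f i)) \<le> m + 1 / Suc i"
      using f(3) by (intro always_eventually allI less_imp_le)
    show "(\<lambda>i. m + 1 / real (Suc i)) \<longlonglongrightarrow> m"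
      using tendsto_add[OF tendsto_const LIMSEQ_inverse_real_of_nat, of m] by (simp add: inverse_eq_divide)
  qed simp
  obtain u r where u: "u \<in> V" "strict_mono r" "Re (Q u u) \<le> m"
    and lim: "(\<lambda>i. Re (ip (\<lambda>x. f (r i) x - u x) (\<lambda>x. f (r i) x - u x))) \<longlonglongrightarrow> 0"
    using compactness[OF fV f(2) fm] by blast
  have "ip u (e j) = 0" if j: "j < k" for j
    using ip.tendsto_left[OF fV u(1) e[OF j] lim] f(1) j by (simp add: W_def LIMSEQ_const_iff)
  then have uW: "u \<in> W" using u by (simp add: W_def)
  have u1: "Re (ip u u) = 1"
    using ip.tendsto_diagonal[OF fV u(1) lim] f(2) by (simp add: LIMSEQ_const_iff)
  have "Re (Q u u) = m" using m_le[OF uW] u u1 by simp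
  then show ?thesis
    using u uW u1 m_le by (intro bexI[of _ u]) (auto simp: W_def)
qed

text \<open>
Minimality says that \<open>Q - \<nu> * ip\<close>, with \<open>\<nu>\<close> the minimum, is positive semidefinite on the constrained
space and vanishes at \<open>u\<close>. By the Cauchy-Schwarz inequality for this form, \<open>u\<close> is then
orthogonal to the constrained space with respect to it, which is the Euler-Lagrange equation there. It extends to
all of \<open>V\<close> since both \<open>ip u\<close> and \<open>Q u\<close> annihilate the earlier eigenvectors.
\<close>

lemma constrained_minimizer_is_eigenvector:
  fixes k :: nat
  assumes e: "\<And>j. j < k \<Longrightarrow> e j \<in> V"
    "\<And>i j. i < k \<Longrightarrow> j < k \<Longrightarrow> ip (e i) (e j) = (if i = j then 1 else 0)"
    "\<And>j v. j < k \<Longrightarrow> v \<in> V \<Longrightarrow> Q (e j) v = of_real (\<mu> j) * ip (e j) v"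
    and u: "u \<in> V" "\<And>j. j < k \<Longrightarrow> ip u (e j) = 0" "Re (ip u u) = 1"
    and min: "\<And>v. v \<in> V \<Longrightarrow> (\<And>j. j < k \<Longrightarrow> ip v (e j) = 0) \<Longrightarrow> Re (Q u u) * Re (ip v v) \<le> Re (Q v v)"
    and v: "v \<in> V"
  shows "Q u v = of_real (Re (Q u u)) * ip u v"
proof -
  define W where "W = {v \<in> V. \<forall>j<k. ip v (e j) = 0}"
  define \<nu> where "\<nu> = Re (Q u u)"
  define R where "R v w = Q v w - of_real \<nu> * ip v w" for v w
  interpret R: hermitian_form W R
  proof
    show "(\<lambda>_. 0) \<in> W" using ip.zero_mem ip.zero_left e(1) by (auto simp: W_def)
    show "(\<lambda>x. v x + c * w x) \<in> W" if "v \<in> W" "w \<in> W" for v w c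
      using that ip.lin_mem ip.left_lin e(1) by (auto simp: W_def)
    show "R (\<lambda>x. v x + c * v' x) w = R v w + c * R v' w" if "v \<in> W" "v' \<in> W" "w \<in> W" for v v' w c
      using that by (auto simp: W_def R_def ip.left_lin en.left_lin algebra_simps)
    show "R w v = cnj (R v w)" if "v \<in> W" "w \<in> W" for v w
      using that ip.hermitian[of v w] en.hermitian[of v w] by (auto simp: W_def R_def)
    show "0 \<le> Re (R v v)" if "v \<in> W" for v
      using that min[of v] by (auto simp: W_def R_def \<nu>_def)
  qed
  have uW: "u \<in> W" using u by (simp add: W_def)
  have "Re (R u u) = 0" by (simp add: R_def \<nu>_def u(3))
  then have ortho: "R u w = 0" if "w \<in> W" for w
    using R.cauchy_schwarz[OF uW that] by simp
  define p where "p = (\<lambda>x. \<Sum>j<k. ip v (e j) * e j x)"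
  define w where "w = (\<lambda>x. v x - p x)"
  have p: "p \<in> V" unfolding p_def using e by (intro ip.sum_mem)
  have ip_p: "ip p (e i) = ip v (e i)" if i: "i < k" for i
  proof -
    have "ip p (e i) = (\<Sum>j<k. ip v (e j) * ip (e j) (e i))"
      unfolding p_def using e i by (intro ip.sum_left) auto
    also have "\<dots> = (\<Sum>j<k. if j = i then ip v (e j) else 0)"
      using e i by (intro sum.cong) auto
    finally show ?thesis using i by simp
  qed
  have wW: "w \<in> W"
    unfolding W_def w_def by (simp add: ip.diff_mem v p ip.left_diff e(1) ip_p)
  have wV: "w \<in> V" using wW by (simp add: W_def)
  have Qe: "Q u (e j) = 0" if "j < k" for j
    using en.hermitian[OF e(1)[OF that] u(1)] e(3)[OF that u(1)] ip.hermitian[OF u(1) e(1)[OF that]]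
      u(2)[OF that] by simp
  have "ip u p = 0" "Q u p = 0"
    unfolding p_def using u e Qe by (simp_all add: ip.sum_right en.sum_right)
  then have "ip u v = ip u w" "Q u v = Q u w"
    using ip.right_lin[OF wV p u(1), of 1] en.right_lin[OF wV p u(1), of 1] by (simp_all add: w_def)
  then show ?thesis
    using ortho[OF wW] by (simp add: R_def \<nu>_def)
qed

text \<open>
The trial condition is a strict inequality for each vector separately. This suffices, since every new
eigenvalue is compared with a single trial vector, one that is orthogonal to the eigenvectors
found before.
\<close>

theorem eigenvectors_below:
  fixes n k :: nat
  assumes w: "\<And>i. i < n \<Longrightarrow> w i \<in> V"
    and trial: "\<And>c. \<exists>i<n. c i \<noteq> 0 \<Longrightarrow>
      Re (Q (\<lambda>x. \<Sum>i<n. c i * w i x) (\<lambda>x. \<Sum>i<n. c i * w i x))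
        < b * Re (ip (\<lambda>x. \<Sum>i<n. c i * w i x) (\<lambda>x. \<Sum>i<n. c i * w i x))"
    and "k \<le> n"
  shows "\<exists>e \<mu>. (\<forall>i<k. e i \<in> V \<and> (\<forall>v\<in>V. Q (e i) v = of_real (\<mu> i) * ip (e i) v) \<and> \<mu> i < b) \<and>
    (\<forall>i<k. \<forall>j<k. ip (e i) (e j) = (if i = j then 1 else 0))"
  using \<open>k \<le> n\<close>
proof (induction k)
  case 0
  show ?case by simp
next
  case (Suc k)
  then obtain e \<mu> where
    "\<forall>i<k. e i \<in> V \<and> (\<forall>v\<in>V. Q (e i) v = of_real (\<mu> i) * ip (e i) v) \<and> \<mu> i < b"
    "\<forall>i<k. \<forall>j<k. ip (e i) (e j) = (if i = j then 1 else 0)"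
    using Suc.IH[OF Suc_leD[OF Suc.prems]] by (elim exE conjE) (rule that)
  then have e: "\<And>i. i < k \<Longrightarrow> e i \<in> V"
    "\<And>i v. i < k \<Longrightarrow> v \<in> V \<Longrightarrow> Q (e i) v = of_real (\<mu> i) * ip (e i) v" "\<And>i. i < k \<Longrightarrow> \<mu> i < b"
    "\<And>i j. i < k \<Longrightarrow> j < k \<Longrightarrow> ip (e i) (e j) = (if i = j then 1 else 0)"
    by simp_all
  obtain c where c: "\<exists>i<n. c i \<noteq> 0" "\<And>j. j < k \<Longrightarrow> (\<Sum>i<n. c i * ip (w i) (e j)) = 0"
    using homogeneous_system_nontrivial[of k n "\<lambda>i j. ip (w i) (e j)"] Suc.prems by auto
  define z where "z = (\<lambda>x. \<Sum>i<n. c i * w i x)"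
  have z: "z \<in> V" unfolding z_def using w by (rule ip.sum_mem)
  have ze: "ip z (e j) = 0" if "j < k" for j
    unfolding z_def using ip.sum_left[OF w e(1)[OF that]] c(2)[OF that] by simp
  have trial_z: "Re (Q z z) < b * Re (ip z z)" using trial[OF c(1)] by (simp add: z_def)
  have pos: "0 < Re (ip z z)"
    using ip.nonneg[OF z] en.nonneg[OF z] trial_z by (cases "Re (ip z z) = 0") auto
  have "\<exists>u\<in>V. (\<forall>j<k. ip u (e j) = 0) \<and> Re (ip u u) = 1 \<and>
    (\<forall>v\<in>V. (\<forall>j<k. ip v (e j) = 0) \<longrightarrow> Re (Q u u) * Re (ip v v) \<le> Re (Q v v))"
    by (intro minimizer_exists[of k e z] e(1) z ze pos)
  then obtain u where u': "u \<in> V" "\<forall>j<k. ip u (e j) = 0" "Re (ip u u) = 1"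
    and min': "\<forall>v\<in>V. (\<forall>j<k. ip v (e j) = 0) \<longrightarrow> Re (Q u u) * Re (ip v v) \<le> Re (Q v v)"
    by (elim bexE conjE) (rule that)
  note u = u'(1) u'(2)[rule_format] u'(3)
  have min: "Re (Q u u) * Re (ip v v) \<le> Re (Q v v)" if "v \<in> V" "\<And>j. j < k \<Longrightarrow> ip v (e j) = 0" for v
    using min' that by blast
  define \<nu> where "\<nu> = Re (Q u u)"
  have eig: "Q u v = of_real \<nu> * ip u v" if "v \<in> V" for v
    unfolding \<nu>_def by (rule constrained_minimizer_is_eigenvector[of k e \<mu> u v, OF e(1,4,2) u min that])
  have "\<nu> * Re (ip z z) < b * Re (ip z z)"
    using min[OF z ze] trial_z by (simp add: \<nu>_def)
  then have below: "\<nu> < b"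
    using pos by simp
  have uu: "ip u u = 1" using ip.diagonal_real[OF u(1)] unfolding u(3) by simp
  have eu: "ip (e j) u = 0" if "j < k" for j
    using ip.hermitian[OF u(1) e(1)[OF that]] u(2)[OF that] by simp
  define e' where "e' = e(k := u)"
  define \<mu>' where "\<mu>' = \<mu>(k := \<nu>)"
  have "e' i \<in> V \<and> (\<forall>v\<in>V. Q (e' i) v = of_real (\<mu>' i) * ip (e' i) v) \<and> \<mu>' i < b" if "i < Suc k" for i
    using that e(1-3) u(1) eig below by (cases "i = k") (simp_all add: e'_def \<mu>'_def)
  moreover have "ip (e' i) (e' j) = (if i = j then 1 else 0)" if "i < Suc k" "j < Suc k" for i j
    using that e(4) u(2) uu eu by (cases "i = k"; cases "j = k") (simp_all add: e'_def)
  ultimately show ?case by blast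
qed

end

section \<open>Square-integrable functions on the line\<close>

definition norm_sq :: "(real \<Rightarrow> complex) \<Rightarrow> real" where
  "norm_sq u = (LINT x|lborel. (cmod (u x))\<^sup>2)"

lemma L2_inner_self: "L2_inner u u = complex_of_real (norm_sq u)"
proof -
  have "L2_inner u u = (LINT x|lborel. complex_of_real ((cmod (u x))\<^sup>2))"
    unfolding L2_inner_def by (simp only: complex_norm_square)
  then show ?thesis by (simp only: norm_sq_def integral_complex_of_real)
qed

lemma cmod_add_square_le: "(cmod (a + b))\<^sup>2 \<le> 2 * (cmod a)\<^sup>2 + 2 * (cmod b)\<^sup>2"
proof -
  have "(cmod (a + b))\<^sup>2 \<le> (cmod a + cmod b)\<^sup>2"
    by (intro power_mono norm_triangle_ineq norm_ge_zero)
  also have "\<dots> \<le> 2 * (cmod a)\<^sup>2 + 2 * (cmod b)\<^sup>2"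
    using zero_le_power2[of "cmod a - cmod b"] by (simp add: power2_eq_square algebra_simps)
  finally show ?thesis .
qed

lemma square_integrable_lin:
  assumes "square_integrable u" "square_integrable v"
  shows "square_integrable (\<lambda>x. u x + c * v x)"
proof -
  have [measurable]: "u \<in> borel_measurable borel" "v \<in> borel_measurable borel"
    and i: "integrable lborel (\<lambda>x. (cmod (u x))\<^sup>2)" "integrable lborel (\<lambda>x. (cmod (v x))\<^sup>2)"
    using assms by (auto simp: square_integrable_def)
  have "integrable lborel (\<lambda>x. 2 * (cmod (u x))\<^sup>2 + 2 * (cmod c)\<^sup>2 * (cmod (v x))\<^sup>2)"
    using i by simp
  then have "integrable lborel (\<lambda>x. (cmod (u x + c * v x))\<^sup>2)"
  proof (rule Bochner_Integration.integrable_bound)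
    show "AE x in lborel. norm ((cmod (u x + c * v x))\<^sup>2)
        \<le> norm (2 * (cmod (u x))\<^sup>2 + 2 * (cmod c)\<^sup>2 * (cmod (v x))\<^sup>2)"
      using cmod_add_square_le[of "u _" "c * v _"] by (intro AE_I2) (simp add: norm_mult power_mult_distrib mult.assoc)
  qed measurable
  then show ?thesis by (simp add: square_integrable_def)
qed

lemma cnj_measurable [measurable]: "cnj \<in> borel_measurable borel"
  by (intro borel_measurable_continuous_onI continuous_intros)

lemma integrable_L2_product:
  assumes "square_integrable u" "square_integrable v"
  shows "integrable lborel (\<lambda>x. u x * cnj (v x))"
proof -
  have [measurable]: "u \<in> borel_measurable borel" "v \<in> borel_measurable borel"
    and i: "integrable lborel (\<lambda>x. (cmod (u x))\<^sup>2)" "integrable lborel (\<lambda>x. (cmod (v x))\<^sup>2)"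
    using assms by (auto simp: square_integrable_def)
  have "integrable lborel (\<lambda>x. (cmod (u x))\<^sup>2 + (cmod (v x))\<^sup>2)"
    using i by simp
  then show ?thesis
  proof (rule Bochner_Integration.integrable_bound)
    have "cmod (u x) * cmod (v x) \<le> (cmod (u x))\<^sup>2 + (cmod (v x))\<^sup>2" for x
      using sum_squares_bound[of "cmod (u x)" "cmod (v x)"]
        mult_nonneg_nonneg[OF norm_ge_zero norm_ge_zero, of "u x" "v x"] by linarith
    then show "AE x in lborel. norm (u x * cnj (v x)) \<le> norm ((cmod (u x))\<^sup>2 + (cmod (v x))\<^sup>2)"
      by (intro AE_I2) (simp add: norm_mult)
  qed measurable
qed

interpretation L2: hermitian_form "Collect square_integrable" L2_inner
proof
  show "(\<lambda>_. 0) \<in> Collect square_integrable" by (simp add: square_integrable_def)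
  show "(\<lambda>x. u x + c * v x) \<in> Collect square_integrable"
    if "u \<in> Collect square_integrable" "v \<in> Collect square_integrable" for u v c
    using that square_integrable_lin by simp
  show "L2_inner (\<lambda>x. u x + c * v x) w = L2_inner u w + c * L2_inner v w"
    if "u \<in> Collect square_integrable" "v \<in> Collect square_integrable" "w \<in> Collect square_integrable" for u v w c
    using that integrable_L2_product[of u w] integrable_L2_product[of v w]
    by (simp add: L2_inner_def ring_distribs mult.assoc)
  show "L2_inner v u = cnj (L2_inner u v)" for u v
  proof -
    have "cnj (L2_inner u v) = (LINT x|lborel. cnj (u x * cnj (v x)))"
      unfolding L2_inner_def by (rule Bochner_Integration.integral_cnj[symmetric])
    then show ?thesis by (simp add: L2_inner_def mult.commute)
  qed
  show "0 \<le> Re (L2_inner u u)" for u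
    by (simp add: L2_inner_self norm_sq_def)
qed

lemma square_integrable_diff:
  "square_integrable u \<Longrightarrow> square_integrable v \<Longrightarrow> square_integrable (\<lambda>x. u x - v x)"
  using L2.diff_mem[of u v] by simp

lemma norm_sq_diff_le:
  "square_integrable u \<Longrightarrow> square_integrable v \<Longrightarrow> norm_sq (\<lambda>x. u x - v x) \<le> 2 * norm_sq u + 2 * norm_sq v"
  using L2.diagonal_diff_le[of u v] by (simp add: L2_inner_self)

lemma norm_sq_nonneg: "0 \<le> norm_sq u"
  by (simp add: norm_sq_def)

lemma norm_sq_tendsto:
  assumes "\<And>i. square_integrable (f i)" "square_integrable u" "((\<lambda>i. norm_sq (\<lambda>x. f i x - u x)) \<longlongrightarrow> 0) F"
  shows "((\<lambda>i. norm_sq (f i)) \<longlongrightarrow> norm_sq u) F"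
  using L2.tendsto_diagonal[of f u F] assms by (simp add: L2_inner_self)

section \<open>Fourier integrals\<close>

definition fourier_integral :: "(real \<Rightarrow> complex) \<Rightarrow> real \<Rightarrow> complex" where
  "fourier_integral u \<xi> = (LINT x|lborel. u x * exp (- (\<i> * complex_of_real (x * \<xi>)))) / sqrt (2 * pi)"

lemma norm_kernel: "cmod (exp (- (\<i> * complex_of_real t))) = 1"
  by (simp add: norm_exp_eq_Re)

lemma fourier_integral_measurable [measurable]:
  assumes [measurable]: "u \<in> borel_measurable borel"
  shows "fourier_integral u \<in> borel_measurable borel"
  unfolding fourier_integral_def by measurable

lemma integrable_kernel:
  assumes "integrable lborel u"
  shows "integrable lborel (\<lambda>x. u x * exp (- (\<i> * complex_of_real (x * \<xi>))))"
proof (rule Bochner_Integration.integrable_bound[OF assms])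
  show "(\<lambda>x. u x * exp (- (\<i> * complex_of_real (x * \<xi>)))) \<in> borel_measurable lborel"
    using borel_measurable_integrable[OF assms] by measurable
qed (simp add: norm_mult norm_kernel del: of_real_mult)

lemma fourier_integral_lin:
  assumes "integrable lborel u" "integrable lborel v"
  shows "fourier_integral (\<lambda>x. u x + c * v x) \<xi> = fourier_integral u \<xi> + c * fourier_integral v \<xi>"
  using integrable_kernel[OF assms(1), of \<xi>] integrable_kernel[OF assms(2), of \<xi>]
  by (simp add: fourier_integral_def ring_distribs add_divide_distrib mult.assoc del: of_real_mult)

lemma fourier_integral_diff:
  assumes "integrable lborel u" "integrable lborel v"
  shows "fourier_integral (\<lambda>x. u x - v x) \<xi> = fourier_integral u \<xi> - fourier_integral v \<xi>"
  using fourier_integral_lin[OF assms, of "-1" \<xi>] by simp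

lemma fourier_integral_le:
  assumes "integrable lborel u"
  shows "cmod (fourier_integral u \<xi>) \<le> (LINT x|lborel. cmod (u x)) / sqrt (2 * pi)"
proof -
  have "cmod (LINT x|lborel. u x * exp (- (\<i> * complex_of_real (x * \<xi>))))
      \<le> (LINT x|lborel. cmod (u x * exp (- (\<i> * complex_of_real (x * \<xi>)))))"
    by (rule integral_norm_bound)
  also have "\<dots> = (LINT x|lborel. cmod (u x))"
    by (simp add: norm_mult norm_kernel del: of_real_mult)
  finally show ?thesis
    by (simp add: fourier_integral_def norm_divide divide_right_mono)
qed

text \<open>
Fubini's theorem, applied to \<open>f x * g \<xi>\<close> times the kernel, which is symmetric in \<open>x\<close> and \<open>\<xi>\<close>.
\<close>

lemma multiplication_formula:
  assumes f: "integrable lborel f" and g: "integrable lborel g"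
  shows "(LINT \<xi>|lborel. fourier_integral f \<xi> * g \<xi>) = (LINT x|lborel. f x * fourier_integral g x)"
proof -
  define h where "h = (\<lambda>x \<xi>. f x * g \<xi> * exp (- (\<i> * complex_of_real (x * \<xi>))))"
  have [measurable]: "f \<in> borel_measurable borel" "g \<in> borel_measurable borel"
    using f g by auto
  have hm: "case_prod h \<in> borel_measurable (lborel \<Otimes>\<^sub>M lborel)"
    unfolding h_def by measurable
  have nh: "cmod (h x \<xi>) = cmod (f x) * cmod (g \<xi>)" for x \<xi>
    by (simp add: h_def norm_mult norm_kernel del: of_real_mult)
  have "integrable (lborel \<Otimes>\<^sub>M lborel) (case_prod h)"
  proof (rule lborel_pair.Fubini_integrable[OF hm])
    show "integrable lborel (\<lambda>x. LINT \<xi>|lborel. norm (case_prod h (x, \<xi>)))"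
      using f by (simp add: nh)
    show "AE x in lborel. integrable lborel (\<lambda>\<xi>. case_prod h (x, \<xi>))"
    proof (intro AE_I2)
      fix x
      have "integrable lborel (\<lambda>\<xi>. f x * (g \<xi> * exp (- (\<i> * complex_of_real (\<xi> * x)))))"
        using integrable_kernel[OF g] by (rule integrable_mult_right)
      then show "integrable lborel (\<lambda>\<xi>. case_prod h (x, \<xi>))"
        by (simp add: h_def mult.assoc mult.commute[of x] del: of_real_mult)
    qed
  qed
  then have "(LINT \<xi>|lborel. LINT x|lborel. h x \<xi>) = (LINT x|lborel. LINT \<xi>|lborel. h x \<xi>)"
    by (rule lborel_pair.Fubini_integral)
  moreover have "(LINT x|lborel. h x \<xi>) = sqrt (2 * pi) * (fourier_integral f \<xi> * g \<xi>)" for \<xi>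
  proof -
    have "(LINT x|lborel. h x \<xi>) = (LINT x|lborel. f x * exp (- (\<i> * complex_of_real (x * \<xi>))) * g \<xi>)"
      by (simp add: h_def mult.assoc mult.commute[of "g \<xi>"] del: of_real_mult)
    then show ?thesis by (simp add: fourier_integral_def)
  qed
  moreover have "(LINT \<xi>|lborel. h x \<xi>) = sqrt (2 * pi) * (f x * fourier_integral g x)" for x
  proof -
    have "(LINT \<xi>|lborel. h x \<xi>) = (LINT \<xi>|lborel. f x * (g \<xi> * exp (- (\<i> * complex_of_real (\<xi> * x)))))"
      by (simp add: h_def mult.assoc mult.commute[of x] del: of_real_mult)
    also have "\<dots> = f x * (LINT \<xi>|lborel. g \<xi> * exp (- (\<i> * complex_of_real (\<xi> * x))))"
      by (rule integral_mult_right_zero)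
    finally show ?thesis by (simp add: fourier_integral_def)
  qed
  ultimately show ?thesis by simp
qed

section \<open>Plancherel's identity by Gaussian summation\<close>

text \<open>
The convolution of \<open>u\<close> with a centred normal density of standard deviation \<open>\<sigma>\<close>, written
after a substitution that leaves \<open>\<sigma>\<close> in the argument of \<open>u\<close> only. In this form the limit \<open>\<sigma> \<longlonglongrightarrow> 0\<close> is a
matter of dominated convergence.
\<close>

definition gaussian_mean :: "real \<Rightarrow> (real \<Rightarrow> complex) \<Rightarrow> real \<Rightarrow> complex" where
  "gaussian_mean \<sigma> u x = (LINT w|lborel. u (x + \<sigma> * w) * complex_of_real (std_normal_density w))"

text \<open>
The characteristic function of the standard normal distribution, without the normalising factor.
\<close>

lemma integral_gaussian_character:
  "(LINT w|lborel. complex_of_real (exp (- w\<^sup>2 / 2)) * exp (\<i> * complex_of_real (t * w)))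
    = complex_of_real (sqrt (2 * pi) * exp (- t\<^sup>2 / 2))"
proof -
  have "char std_normal_distribution t = complex_of_real (exp (- t\<^sup>2 / 2))"
    by (simp add: char_std_normal_distribution)
  moreover have "char std_normal_distribution t
      = (LINT w|lborel. std_normal_density w *\<^sub>R exp (\<i> * complex_of_real (t * w)))"
    unfolding char_def by (subst integral_density) auto
  moreover have "\<dots> = (LINT w|lborel. complex_of_real (1 / sqrt (2 * pi))
      * (complex_of_real (exp (- w\<^sup>2 / 2)) * exp (\<i> * complex_of_real (t * w))))"
    by (simp add: std_normal_density_def scaleR_conv_of_real)
  ultimately show ?thesis
    by (simp add: field_simps flip: of_real_exp)
qed

lemma integrable_gaussian:
  assumes "0 < \<sigma>"
  shows "integrable lborel (\<lambda>\<xi>::real. exp (- (\<sigma> * \<xi>)\<^sup>2 / 2))"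
proof -
  have "integrable lborel (\<lambda>\<xi>. sqrt (2 * pi * (1 / \<sigma>)\<^sup>2) * normal_density 0 (1 / \<sigma>) \<xi>)"
    using assms by (intro integrable_mult_right integrable_normal_density) simp
  then show ?thesis
    using assms by (simp add: normal_density_def power_mult_distrib power_divide field_simps real_sqrt_mult real_sqrt_divide)
qed

lemma integral_scaled_gaussian_character:
  assumes "0 < \<sigma>"
  shows "(LINT \<xi>|lborel. complex_of_real (exp (- (\<sigma> * \<xi>)\<^sup>2 / 2)) * exp (\<i> * complex_of_real (t * \<xi>)))
    = complex_of_real (sqrt (2 * pi) / \<sigma> * exp (- (t / \<sigma>)\<^sup>2 / 2))"
proof -
  have "(LINT \<xi>|lborel. complex_of_real (exp (- (\<sigma> * \<xi>)\<^sup>2 / 2)) * exp (\<i> * complex_of_real (t * \<xi>)))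
     = (1 / \<sigma>) *\<^sub>R (LINT w|lborel. complex_of_real (exp (- (\<sigma> * (0 + 1 / \<sigma> * w))\<^sup>2 / 2))
          * exp (\<i> * complex_of_real (t * (0 + 1 / \<sigma> * w))))"
    using assms by (subst lborel_integral_real_affine[of "1 / \<sigma>" _ 0]) auto
  also have "(LINT w|lborel. complex_of_real (exp (- (\<sigma> * (0 + 1 / \<sigma> * w))\<^sup>2 / 2))
          * exp (\<i> * complex_of_real (t * (0 + 1 / \<sigma> * w))))
     = (LINT w|lborel. complex_of_real (exp (- w\<^sup>2 / 2)) * exp (\<i> * complex_of_real (t / \<sigma> * w)))"
    using assms by simp
  finally show ?thesis
    unfolding integral_gaussian_character by (simp add: scaleR_conv_of_real)
qed

text \<open>
The multiplication formula moves the transform from \<open>u\<close> to the modulated Gaussian, whose transform is a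
Gaussian centred at \<open>x\<close>.
\<close>

lemma gaussian_summation_pointwise:
  assumes u: "integrable lborel u" and "0 < \<sigma>"
  shows "(LINT \<xi>|lborel. fourier_integral u \<xi> * (complex_of_real (exp (- (\<sigma> * \<xi>)\<^sup>2 / 2)) * exp (\<i> * complex_of_real (x * \<xi>))))
    = sqrt (2 * pi) * gaussian_mean \<sigma> u x"
proof -
  define h where "h = (\<lambda>\<xi>. complex_of_real (exp (- (\<sigma> * \<xi>)\<^sup>2 / 2)) * exp (\<i> * complex_of_real (x * \<xi>)))"
  have h: "integrable lborel h"
    by (rule Bochner_Integration.integrable_bound[OF integrable_gaussian[OF \<open>0 < \<sigma>\<close>]])
      (auto simp: h_def norm_mult norm_exp_eq_Re simp del: of_real_exp of_real_mult)
  have Fh: "fourier_integral h y = complex_of_real (1 / \<sigma> * exp (- ((x - y) / \<sigma>)\<^sup>2 / 2))" for y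
  proof -
    have "(LINT \<xi>|lborel. h \<xi> * exp (- (\<i> * complex_of_real (\<xi> * y))))
      = (LINT \<xi>|lborel. complex_of_real (exp (- (\<sigma> * \<xi>)\<^sup>2 / 2)) * exp (\<i> * complex_of_real ((x - y) * \<xi>)))"
      unfolding h_def mult.assoc exp_add[symmetric] by (simp add: algebra_simps)
    then show ?thesis
      unfolding fourier_integral_def integral_scaled_gaussian_character[OF \<open>0 < \<sigma>\<close>]
      by (simp add: divide_simps)
  qed
  have "(LINT \<xi>|lborel. fourier_integral u \<xi> * h \<xi>)
     = (LINT y|lborel. u y * complex_of_real (1 / \<sigma> * exp (- ((x - y) / \<sigma>)\<^sup>2 / 2)))"
    unfolding multiplication_formula[OF u h] Fh ..
  also have "\<dots> = \<sigma> *\<^sub>R (LINT w|lborel. u (x + \<sigma> * w) * complex_of_real (1 / \<sigma> * exp (- ((x - (x + \<sigma> * w)) / \<sigma>)\<^sup>2 / 2)))"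
    using \<open>0 < \<sigma>\<close> by (subst lborel_integral_real_affine[of \<sigma> _ x]) auto
  also have "\<dots> = (LINT w|lborel. \<sigma> *\<^sub>R (u (x + \<sigma> * w) * complex_of_real (1 / \<sigma> * exp (- ((x - (x + \<sigma> * w)) / \<sigma>)\<^sup>2 / 2))))"
    by (rule integral_scaleR_right[symmetric])
  also have "\<dots> = (LINT w|lborel. sqrt (2 * pi) * (u (x + \<sigma> * w) * complex_of_real (std_normal_density w)))"
    using \<open>0 < \<sigma>\<close> by (simp add: std_normal_density_def scaleR_conv_of_real)
  finally show ?thesis by (simp add: h_def gaussian_mean_def)
qed

text \<open>
A second use of the multiplication formula, with \<open>\<phi>\<close> the conjugate transform damped by the Gaussian.
\<close>

lemma gaussian_summation:
  assumes u: "integrable lborel u" and "0 < \<sigma>"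
  shows "integrable lborel (\<lambda>\<xi>. (cmod (fourier_integral u \<xi>))\<^sup>2 * exp (- (\<sigma> * \<xi>)\<^sup>2 / 2))"
    and "complex_of_real (LINT \<xi>|lborel. (cmod (fourier_integral u \<xi>))\<^sup>2 * exp (- (\<sigma> * \<xi>)\<^sup>2 / 2))
      = (LINT x|lborel. u x * cnj (gaussian_mean \<sigma> u x))"
proof -
  define C where "C = (LINT x|lborel. cmod (u x)) / sqrt (2 * pi)"
  have C: "cmod (fourier_integral u \<xi>) \<le> C" for \<xi>
    unfolding C_def by (rule fourier_integral_le[OF u])
  have [measurable]: "u \<in> borel_measurable borel" using u by auto
  have "integrable lborel (\<lambda>\<xi>. C\<^sup>2 * exp (- (\<sigma> * \<xi>)\<^sup>2 / 2))"
    by (intro integrable_mult_right integrable_gaussian assms)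
  then show "integrable lborel (\<lambda>\<xi>. (cmod (fourier_integral u \<xi>))\<^sup>2 * exp (- (\<sigma> * \<xi>)\<^sup>2 / 2))"
    by (rule Bochner_Integration.integrable_bound) (use C in \<open>auto simp: abs_mult power_mono\<close>)
  define \<phi> where "\<phi> = (\<lambda>\<xi>. cnj (fourier_integral u \<xi>) * complex_of_real (exp (- (\<sigma> * \<xi>)\<^sup>2 / 2)))"
  have "integrable lborel (\<lambda>\<xi>. C * exp (- (\<sigma> * \<xi>)\<^sup>2 / 2))"
    by (intro integrable_mult_right integrable_gaussian assms)
  then have \<phi>: "integrable lborel \<phi>"
    by (rule Bochner_Integration.integrable_bound)
      (use C order_trans[OF norm_ge_zero C] in \<open>auto simp: \<phi>_def norm_mult abs_mult simp del: of_real_exp\<close>)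
  have F\<phi>: "fourier_integral \<phi> x = cnj (gaussian_mean \<sigma> u x)" for x
  proof -
    have "(LINT \<xi>|lborel. \<phi> \<xi> * exp (- (\<i> * complex_of_real (\<xi> * x))))
      = (LINT \<xi>|lborel. cnj (fourier_integral u \<xi> * (complex_of_real (exp (- (\<sigma> * \<xi>)\<^sup>2 / 2)) * exp (\<i> * complex_of_real (x * \<xi>)))))"
      by (simp add: \<phi>_def exp_cnj mult.commute[of x] mult.assoc)
    also have "\<dots> = cnj (LINT \<xi>|lborel. fourier_integral u \<xi> * (complex_of_real (exp (- (\<sigma> * \<xi>)\<^sup>2 / 2)) * exp (\<i> * complex_of_real (x * \<xi>))))"
      by (rule Bochner_Integration.integral_cnj)
    finally show ?thesis
      unfolding fourier_integral_def[of \<phi>] gaussian_summation_pointwise[OF assms] by simp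
  qed
  have "complex_of_real ((cmod (fourier_integral u \<xi>))\<^sup>2 * exp (- (\<sigma> * \<xi>)\<^sup>2 / 2)) = fourier_integral u \<xi> * \<phi> \<xi>" for \<xi>
    unfolding \<phi>_def of_real_mult complex_norm_square by (simp add: mult.assoc)
  then have "complex_of_real (LINT \<xi>|lborel. (cmod (fourier_integral u \<xi>))\<^sup>2 * exp (- (\<sigma> * \<xi>)\<^sup>2 / 2))
      = (LINT \<xi>|lborel. fourier_integral u \<xi> * \<phi> \<xi>)"
    by (simp only: integral_complex_of_real[symmetric])
  then show "complex_of_real (LINT \<xi>|lborel. (cmod (fourier_integral u \<xi>))\<^sup>2 * exp (- (\<sigma> * \<xi>)\<^sup>2 / 2))
      = (LINT x|lborel. u x * cnj (gaussian_mean \<sigma> u x))"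
    unfolding multiplication_formula[OF u \<phi>] F\<phi> .
qed

text \<open>
Let \<open>\<sigma>\<close> tend to 0 in Gaussian summation. The left-hand side increases to the integral of the squared
transform, which gives its integrability and its value at once; on the right-hand side the Gaussian means
converge to \<open>u\<close> at every point of continuity and are bounded by \<open>M\<close>.
\<close>

lemma plancherel_continuous:
  assumes u: "integrable lborel u" and M: "\<And>x. cmod (u x) \<le> M" and cont: "AE x in lborel. isCont u x"
  shows "square_integrable u" "square_integrable (fourier_integral u)" "norm_sq (fourier_integral u) = norm_sq u"
proof -
  have [measurable]: "u \<in> borel_measurable borel" using u by auto
  have M0: "0 \<le> M" using norm_ge_zero M order_trans by blast
  have "integrable lborel (\<lambda>x. M * cmod (u x))" using u by simp
  then have i2: "integrable lborel (\<lambda>x. (cmod (u x))\<^sup>2)"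
    by (rule Bochner_Integration.integrable_bound)
      (use M M0 in \<open>auto simp: power2_eq_square abs_mult intro!: mult_right_mono\<close>)
  then show "square_integrable u" by (simp add: square_integrable_def)
  define \<sigma> where "\<sigma> k = 1 / real (Suc k)" for k
  have \<sigma>: "0 < \<sigma> k" for k by (simp add: \<sigma>_def)
  have \<sigma>0: "\<sigma> \<longlonglongrightarrow> 0"
    unfolding \<sigma>_def using LIMSEQ_inverse_real_of_nat by (simp add: inverse_eq_divide)
  have dens: "integrable lborel std_normal_density" "(LINT w|lborel. std_normal_density w) = 1"
    using integrable_normal_density[of 1 0] integral_normal_density[of 1 0] by simp_all
  have mean_lim: "(\<lambda>k. gaussian_mean (\<sigma> k) u x) \<longlonglongrightarrow> u x" if "isCont u x" for x
  proof -
    have "(\<lambda>k. gaussian_mean (\<sigma> k) u x) \<longlonglongrightarrow> (LINT w|lborel. u x * complex_of_real (std_normal_density w))"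
      unfolding gaussian_mean_def
    proof (rule integral_dominated_convergence[where w = "\<lambda>w. M * std_normal_density w"])
      show "AE w in lborel. (\<lambda>k. u (x + \<sigma> k * w) * complex_of_real (std_normal_density w))
          \<longlonglongrightarrow> u x * complex_of_real (std_normal_density w)"
      proof (intro AE_I2 tendsto_mult tendsto_const isCont_tendsto_compose[OF that])
        fix w show "(\<lambda>k. x + \<sigma> k * w) \<longlonglongrightarrow> x"
          using tendsto_add[OF tendsto_const tendsto_mult_left_zero[OF \<sigma>0], of x w] by simp
      qed
      show "AE w in lborel. norm (u (x + \<sigma> k * w) * complex_of_real (std_normal_density w))
          \<le> M * std_normal_density w" for k
        using M by (intro AE_I2) (simp add: norm_mult mult_right_mono)
    qed (use dens in auto)
    then show ?thesis using dens(2) by simp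
  qed
  have mean_le: "cmod (gaussian_mean (\<sigma> k) u x) \<le> M" for k x
  proof -
    have "cmod (gaussian_mean (\<sigma> k) u x) \<le> (LINT w|lborel. cmod (u (x + \<sigma> k * w) * complex_of_real (std_normal_density w)))"
      unfolding gaussian_mean_def by (rule integral_norm_bound)
    also have "\<dots> \<le> (LINT w|lborel. M * std_normal_density w)"
    proof (rule integral_mono_AE')
      show "integrable lborel (\<lambda>w. M * std_normal_density w)" using dens by simp
    qed (use M M0 in \<open>auto simp: norm_mult mult_right_mono\<close>)
    finally show ?thesis using dens by simp
  qed
  define I where "I k = (LINT \<xi>|lborel. (cmod (fourier_integral u \<xi>))\<^sup>2 * exp (- (\<sigma> k * \<xi>)\<^sup>2 / 2))" for k
  have "(\<lambda>k. LINT x|lborel. u x * cnj (gaussian_mean (\<sigma> k) u x)) \<longlonglongrightarrow> (LINT x|lborel. u x * cnj (u x))"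
  proof (rule integral_dominated_convergence[where w = "\<lambda>x. M * cmod (u x)"])
    show "AE x in lborel. (\<lambda>k. u x * cnj (gaussian_mean (\<sigma> k) u x)) \<longlonglongrightarrow> u x * cnj (u x)"
      using cont by eventually_elim (intro tendsto_intros mean_lim)
    show "AE x in lborel. norm (u x * cnj (gaussian_mean (\<sigma> k) u x)) \<le> M * cmod (u x)" for k
      using mean_le by (intro AE_I2) (simp add: norm_mult mult.commute[of "cmod (u _)"] mult_right_mono)
    show "(\<lambda>x. u x * cnj (gaussian_mean (\<sigma> k) u x)) \<in> borel_measurable lborel" for k
      unfolding gaussian_mean_def by measurable
  qed (use u in auto)
  then have "(\<lambda>k. complex_of_real (I k)) \<longlonglongrightarrow> complex_of_real (norm_sq u)"
    unfolding I_def gaussian_summation(2)[OF u \<sigma>] L2_inner_self[symmetric] L2_inner_def .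
  then have I: "I \<longlonglongrightarrow> norm_sq u"
    by (simp add: tendsto_of_real_iff)
  have mono: "mono (\<lambda>k. (cmod (fourier_integral u \<xi>))\<^sup>2 * exp (- (\<sigma> k * \<xi>)\<^sup>2 / 2))" for \<xi>
  proof (intro monoI mult_left_mono)
    fix k l :: nat assume "k \<le> l"
    then have "\<sigma> l \<le> \<sigma> k" by (simp add: \<sigma>_def frac_le)
    then have "\<sigma> l * \<bar>\<xi>\<bar> \<le> \<sigma> k * \<bar>\<xi>\<bar>" by (simp add: mult_right_mono)
    then have "\<bar>\<sigma> l * \<xi>\<bar> \<le> \<bar>\<sigma> k * \<xi>\<bar>" using \<sigma>[of k] \<sigma>[of l] by (simp add: abs_mult)
    then have "(\<sigma> l * \<xi>)\<^sup>2 \<le> (\<sigma> k * \<xi>)\<^sup>2" by (simp only: abs_le_square_iff)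
    then show "exp (- (\<sigma> k * \<xi>)\<^sup>2 / 2) \<le> exp (- (\<sigma> l * \<xi>)\<^sup>2 / 2)" by simp
  qed simp
  have lim: "(\<lambda>k. (cmod (fourier_integral u \<xi>))\<^sup>2 * exp (- (\<sigma> k * \<xi>)\<^sup>2 / 2)) \<longlonglongrightarrow> (cmod (fourier_integral u \<xi>))\<^sup>2" for \<xi>
  proof -
    have "(\<lambda>k. (cmod (fourier_integral u \<xi>))\<^sup>2 * exp (- (\<sigma> k * \<xi>)\<^sup>2 / 2))
        \<longlonglongrightarrow> (cmod (fourier_integral u \<xi>))\<^sup>2 * exp (- (0 * \<xi>)\<^sup>2 / 2)"
      by (intro tendsto_intros \<sigma>0) auto
    then show ?thesis by simp
  qed
  have mc: "integrable lborel (\<lambda>\<xi>. (cmod (fourier_integral u \<xi>))\<^sup>2)"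
    "(LINT \<xi>|lborel. (cmod (fourier_integral u \<xi>))\<^sup>2) = norm_sq u"
    using integrable_monotone_convergence[OF gaussian_summation(1)[OF u \<sigma>] AE_I2[OF mono] AE_I2[OF lim] I[unfolded I_def]]
      integral_monotone_convergence[OF gaussian_summation(1)[OF u \<sigma>] AE_I2[OF mono] AE_I2[OF lim] I[unfolded I_def]]
    by simp_all
  then show "square_integrable (fourier_integral u)" "norm_sq (fourier_integral u) = norm_sq u"
    by (simp_all add: square_integrable_def norm_sq_def)
qed

section \<open>Plancherel's identity for functions supported in an interval\<close>

definition L2_on :: "real \<Rightarrow> (real \<Rightarrow> complex) set" where
  "L2_on L = {u. square_integrable u \<and> (AE x in lborel. x \<notin> {0<..<L} \<longrightarrow> u x = 0)}"

lemma L2_on_square_integrable: "u \<in> L2_on L \<Longrightarrow> square_integrable u"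
  by (simp add: L2_on_def)

lemma L2_on_measurable [measurable_dest]: "u \<in> L2_on L \<Longrightarrow> u \<in> borel_measurable borel"
  by (simp add: L2_on_def square_integrable_def)

lemma L2_on_lin:
  assumes "u \<in> L2_on L" "v \<in> L2_on L"
  shows "(\<lambda>x. u x + c * v x) \<in> L2_on L"
proof -
  have "AE x in lborel. x \<notin> {0<..<L} \<longrightarrow> u x = 0" "AE x in lborel. x \<notin> {0<..<L} \<longrightarrow> v x = 0"
    using assms by (auto simp: L2_on_def)
  then have "AE x in lborel. x \<notin> {0<..<L} \<longrightarrow> u x + c * v x = 0"
    by eventually_elim simp
  then show ?thesis using assms square_integrable_lin by (simp add: L2_on_def)
qed

lemma L2_on_diff: "u \<in> L2_on L \<Longrightarrow> v \<in> L2_on L \<Longrightarrow> (\<lambda>x. u x - v x) \<in> L2_on L"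
  using L2_on_lin[of u L v "-1"] by simp

lemma integrable_indicator_Ioo: "integrable lborel (indicator {0<..<L::real} :: real \<Rightarrow> real)"
  by (cases "0 \<le> L") (auto simp: integrable_real_indicator emeasure_lborel_Ioo)

lemma L2_on_integrable:
  assumes u: "u \<in> L2_on L"
  shows "integrable lborel u"
proof -
  have [measurable]: "u \<in> borel_measurable borel" and supp: "AE x in lborel. x \<notin> {0<..<L} \<longrightarrow> u x = 0"
    and i: "integrable lborel (\<lambda>x. (cmod (u x))\<^sup>2)"
    using u by (auto simp: L2_on_def square_integrable_def)
  have "integrable lborel (\<lambda>x. (cmod (u x))\<^sup>2 + indicator {0<..<L} x)"
    by (rule Bochner_Integration.integrable_add[OF i integrable_indicator_Ioo])
  then show ?thesis
  proof (rule Bochner_Integration.integrable_bound)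
    show "AE x in lborel. norm (u x) \<le> norm ((cmod (u x))\<^sup>2 + indicator {0<..<L} x :: real)"
      using supp
    proof eventually_elim
      fix x assume x: "x \<notin> {0<..<L} \<longrightarrow> u x = 0"
      have "cmod (u x) \<le> (cmod (u x))\<^sup>2 + 1"
        using zero_le_power2[of "cmod (u x) - 1"] norm_ge_zero[of "u x"]
        unfolding power2_diff power_one mult_1_right by linarith
      with x show "norm (u x) \<le> norm ((cmod (u x))\<^sup>2 + indicator {0<..<L} x :: real)"
        by (cases "x \<in> {0<..<L}") auto
    qed
  qed measurable
qed

text \<open>
Cauchy-Schwarz with the indicator function of the interval.
\<close>

lemma L1_le_L2:
  assumes u: "u \<in> L2_on L" and "0 \<le> L"
  shows "(LINT x|lborel. cmod (u x))\<^sup>2 \<le> L * norm_sq u"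
proof -
  have [measurable]: "u \<in> borel_measurable borel" and supp: "AE x in lborel. x \<notin> {0<..<L} \<longrightarrow> u x = 0"
    and i: "integrable lborel (\<lambda>x. (cmod (u x))\<^sup>2)"
    using u by (auto simp: L2_on_def square_integrable_def)
  define a where "a x = complex_of_real (cmod (u x))" for x
  define b where "b x = complex_of_real (indicator {0<..<L} x)" for x :: real
  have [measurable]: "a \<in> borel_measurable borel" "b \<in> borel_measurable borel"
    unfolding a_def b_def by measurable
  have b2: "(cmod (b x))\<^sup>2 = indicator {0<..<L} x" for x
    by (simp add: b_def split: split_indicator)
  have a: "square_integrable a" "norm_sq a = norm_sq u"
    using i by (simp_all add: square_integrable_def norm_sq_def) (simp_all add: a_def)
  have b: "square_integrable b" "norm_sq b = L"
    using \<open>0 \<le> L\<close> by (simp_all add: square_integrable_def norm_sq_def b2 integrable_indicator_Ioo)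
  have "L2_inner a b = (LINT x|lborel. complex_of_real (cmod (u x)))"
    unfolding L2_inner_def
  proof (rule integral_cong_AE)
    show "AE x in lborel. a x * cnj (b x) = complex_of_real (cmod (u x))"
      using supp by eventually_elim (auto simp: a_def b_def split: split_indicator)
  qed (simp_all add: a_def b_def)
  also have "\<dots> = complex_of_real (LINT x|lborel. cmod (u x))"
    by (rule integral_complex_of_real)
  finally have "(cmod (L2_inner a b))\<^sup>2 = (LINT x|lborel. cmod (u x))\<^sup>2"
    by simp
  then show ?thesis
    using L2.cauchy_schwarz[of a b] a b by (simp add: L2_inner_self mult.commute)
qed

lemma fourier_integral_square_le:
  assumes u: "u \<in> L2_on L" and "0 \<le> L"
  shows "(cmod (fourier_integral u \<xi>))\<^sup>2 \<le> L / (2 * pi) * norm_sq u"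
proof -
  have "(cmod (fourier_integral u \<xi>))\<^sup>2 \<le> ((LINT x|lborel. cmod (u x)) / sqrt (2 * pi))\<^sup>2"
    by (intro power_mono fourier_integral_le L2_on_integrable[OF u]) simp
  also have "\<dots> = (LINT x|lborel. cmod (u x))\<^sup>2 / (2 * pi)"
    by (simp add: power_divide)
  also have "\<dots> \<le> L * norm_sq u / (2 * pi)"
    by (intro divide_right_mono L1_le_L2 assms) simp
  finally show ?thesis by simp
qed

text \<open>
On a fixed interval, convergence in the mean implies convergence of integrals, and therefore pointwise
convergence of the transforms. This is what allows Fatou's lemma to be used on the Fourier side.
\<close>

lemma fourier_integral_tendsto:
  assumes f: "\<And>i. f i \<in> L2_on L" and u: "u \<in> L2_on L" and "0 \<le> L"
    and lim: "((\<lambda>i. norm_sq (\<lambda>x. f i x - u x)) \<longlongrightarrow> 0) F"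
  shows "((\<lambda>i. fourier_integral (f i) \<xi>) \<longlongrightarrow> fourier_integral u \<xi>) F"
proof -
  have le: "(cmod (fourier_integral (f i) \<xi> - fourier_integral u \<xi>))\<^sup>2 \<le> L / (2 * pi) * norm_sq (\<lambda>x. f i x - u x)" for i
    using fourier_integral_square_le[OF L2_on_diff[OF f u] \<open>0 \<le> L\<close>]
    by (simp add: fourier_integral_diff L2_on_integrable[OF f] L2_on_integrable[OF u])
  have "((\<lambda>i. sqrt (L / (2 * pi) * norm_sq (\<lambda>x. f i x - u x))) \<longlongrightarrow> sqrt 0) F"
    by (rule tendsto_real_sqrt[OF tendsto_mult_right_zero[OF lim]])
  moreover have "cmod (fourier_integral (f i) \<xi> - fourier_integral u \<xi>) \<le> sqrt (L / (2 * pi) * norm_sq (\<lambda>x. f i x - u x))" for i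
    using le by (rule real_le_rsqrt)
  ultimately have "((\<lambda>i. fourier_integral (f i) \<xi> - fourier_integral u \<xi>) \<longlongrightarrow> 0) F"
    by (intro Lim_null_comparison[of "\<lambda>i. fourier_integral (f i) \<xi> - fourier_integral u \<xi>"]) auto
  then show ?thesis by (rule LIM_zero_cancel)
qed

lemma fatou_bound:
  fixes h :: "real \<Rightarrow> real"
  assumes [measurable]: "h \<in> borel_measurable borel"
    and g: "\<And>k. integrable lborel (g k)" "\<And>k x. 0 \<le> g k x"
    and bound: "\<forall>\<^sub>F k in sequentially. (LINT x|lborel. g k x) \<le> c"
    and lim: "AE x in lborel. (\<lambda>k. g k x) \<longlonglongrightarrow> h x"
  shows "integrable lborel h" "(LINT x|lborel. h x) \<le> c"
proof -
  have [measurable]: "g k \<in> borel_measurable borel" for k using g(1)[of k] by auto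
  have h0: "AE x in lborel. 0 \<le> h x"
    using lim by eventually_elim (auto intro: LIMSEQ_le_const g(2))
  obtain k where "(LINT x|lborel. g k x) \<le> c"
    using eventually_happens'[OF _ bound] by auto
  then have c: "0 \<le> c" using Bochner_Integration.integral_nonneg[of lborel "g k"] g(2) by (metis order_trans)
  have "(\<integral>\<^sup>+x. ennreal (h x) \<partial>lborel) = (\<integral>\<^sup>+x. liminf (\<lambda>k. ennreal (g k x)) \<partial>lborel)"
  proof (rule nn_integral_cong_AE)
    show "AE x in lborel. ennreal (h x) = liminf (\<lambda>k. ennreal (g k x))"
      using lim by eventually_elim (metis lim_imp_Liminf tendsto_ennrealI trivial_limit_sequentially)
  qed
  also have "\<dots> \<le> liminf (\<lambda>k. \<integral>\<^sup>+x. ennreal (g k x) \<partial>lborel)"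
    by (rule nn_integral_liminf) measurable
  also have "\<dots> = liminf (\<lambda>k. ennreal (LINT x|lborel. g k x))"
    using g by (simp add: nn_integral_eq_integral)
  also have "\<dots> \<le> ennreal c"
    using bound by (intro Liminf_le) (auto elim: eventually_mono intro: ennreal_leI)
  finally have le: "(\<integral>\<^sup>+x. ennreal (h x) \<partial>lborel) \<le> ennreal c" .
  then have fin: "(\<integral>\<^sup>+x. ennreal (h x) \<partial>lborel) < \<infinity>"
    using ennreal_less_top[of c] by (simp add: order_le_less_trans)
  show i: "integrable lborel h"
    by (rule integrableI_nonneg[OF _ h0 fin]) simp
  show "(LINT x|lborel. h x) \<le> c"
    using le nn_integral_eq_integral[OF i h0] c by simp
qed

lemma norm_sq_fatou:
  assumes "u \<in> borel_measurable borel" "\<And>k. square_integrable (f k)"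
    "\<forall>\<^sub>F k in sequentially. norm_sq (f k) \<le> c" "AE x in lborel. (\<lambda>k. f k x) \<longlonglongrightarrow> u x"
  shows "square_integrable u" "norm_sq u \<le> c"
proof -
  have [measurable]: "u \<in> borel_measurable borel" by fact
  have "AE x in lborel. (\<lambda>k. (cmod (f k x))\<^sup>2) \<longlonglongrightarrow> (cmod (u x))\<^sup>2"
    using assms(4) by eventually_elim (intro tendsto_intros)
  then have "integrable lborel (\<lambda>x. (cmod (u x))\<^sup>2)" "(LINT x|lborel. (cmod (u x))\<^sup>2) \<le> c"
    using fatou_bound[of "\<lambda>x. (cmod (u x))\<^sup>2" "\<lambda>k x. (cmod (f k x))\<^sup>2" c] assms(2,3)
    by (simp_all add: square_integrable_def norm_sq_def)
  then show "square_integrable u" "norm_sq u \<le> c"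
    by (simp_all add: square_integrable_def norm_sq_def)
qed

text \<open>
The identity is stable under convergence in the mean. Since it is assumed for differences too, the
transforms of the approximants form a Cauchy sequence; Fatou's lemma, applied to the pointwise limits,
identifies the limit with the transform of \<open>u\<close>.
\<close>

lemma plancherel_L2_limit:
  assumes g: "\<And>n::nat. g n \<in> L2_on L" and u: "u \<in> L2_on L" and "0 \<le> L"
    and lim: "(\<lambda>n. norm_sq (\<lambda>x. g n x - u x)) \<longlonglongrightarrow> 0"
    and sq: "\<And>n. square_integrable (fourier_integral (g n))"
    and iso: "\<And>n. norm_sq (fourier_integral (g n)) = norm_sq (g n)"
    and isod: "\<And>n m. norm_sq (fourier_integral (\<lambda>x. g n x - g m x)) = norm_sq (\<lambda>x. g n x - g m x)"
  shows "square_integrable (fourier_integral u)" "norm_sq (fourier_integral u) = norm_sq u"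
proof -
  have [measurable]: "u \<in> borel_measurable borel" "g n \<in> borel_measurable borel" for n
    using u g[of n] by (simp_all add: L2_on_measurable)
  define D where "D n = (\<lambda>\<xi>. fourier_integral (g n) \<xi> - fourier_integral u \<xi>)" for n
  \<comment> \<open>The summand \<open>2 / Suc n\<close> leaves room for the error of the approximants \<open>g m\<close>, which is eventually small but need not vanish.\<close>
  have D: "square_integrable (D n)" "norm_sq (D n) \<le> 2 * norm_sq (\<lambda>x. g n x - u x) + 2 / real (Suc n)" for n
  proof -
    define f where "f m = (\<lambda>\<xi>. fourier_integral (g n) \<xi> - fourier_integral (g m) \<xi>)" for m
    have f_eq: "f m = fourier_integral (\<lambda>x. g n x - g m x)" for m
      by (simp add: f_def fourier_integral_diff L2_on_integrable[OF g] fun_eq_iff)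
    have le: "norm_sq (f m) \<le> 2 * norm_sq (\<lambda>x. g n x - u x) + 2 * norm_sq (\<lambda>x. g m x - u x)" for m
      using norm_sq_diff_le[OF L2_on_square_integrable[OF L2_on_diff[OF g[of n] u]]
          L2_on_square_integrable[OF L2_on_diff[OF g[of m] u]]]
      by (simp add: f_eq isod)
    have "\<forall>\<^sub>F m in sequentially. norm_sq (\<lambda>x. g m x - u x) < 1 / real (Suc n)"
      by (rule order_tendstoD[OF lim]) simp
    then have bound: "\<forall>\<^sub>F m in sequentially. norm_sq (f m) \<le> 2 * norm_sq (\<lambda>x. g n x - u x) + 2 / real (Suc n)"
    proof eventually_elim
      case (elim m)
      then have "2 * norm_sq (\<lambda>x. g m x - u x) \<le> 2 / real (Suc n)" by (simp add: field_simps)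
      with le[of m] show ?case by linarith
    qed
    have ptw: "(\<lambda>m. f m \<xi>) \<longlonglongrightarrow> D n \<xi>" for \<xi>
      unfolding f_def D_def
      by (intro tendsto_diff tendsto_const fourier_integral_tendsto[OF g u \<open>0 \<le> L\<close> lim])
    have fsq: "square_integrable (f m)" for m
      unfolding f_def by (intro square_integrable_diff sq)
    have meas: "D n \<in> borel_measurable borel" unfolding D_def by measurable
    show "square_integrable (D n)" "norm_sq (D n) \<le> 2 * norm_sq (\<lambda>x. g n x - u x) + 2 / real (Suc n)"
      using norm_sq_fatou[OF meas fsq bound AE_I2[OF ptw]] by auto
  qed
  have "fourier_integral u = (\<lambda>\<xi>. fourier_integral (g 0) \<xi> - D 0 \<xi>)"
    by (simp add: D_def)
  then show squ: "square_integrable (fourier_integral u)"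
    using square_integrable_diff[OF sq D(1), of 0 0] by simp
  have "(\<lambda>n. 2 * norm_sq (\<lambda>x. g n x - u x) + 2 * (1 / real (Suc n))) \<longlonglongrightarrow> 2 * 0 + 2 * 0"
    using LIMSEQ_inverse_real_of_nat by (intro tendsto_add tendsto_mult lim tendsto_const) (simp add: inverse_eq_divide)
  then have "(\<lambda>n. norm_sq (D n)) \<longlonglongrightarrow> 0"
    using D(2) by (intro tendsto_sandwich[of "\<lambda>_. 0" "\<lambda>n. norm_sq (D n)" sequentially
        "\<lambda>n. 2 * norm_sq (\<lambda>x. g n x - u x) + 2 * (1 / real (Suc n))"])
      (auto simp: norm_sq_nonneg intro!: always_eventually)
  then have "(\<lambda>n. norm_sq (fourier_integral (g n))) \<longlonglongrightarrow> norm_sq (fourier_integral u)"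
    unfolding D_def by (rule norm_sq_tendsto[OF sq squ])
  moreover have "(\<lambda>n. norm_sq (g n)) \<longlonglongrightarrow> norm_sq u"
    by (rule norm_sq_tendsto[OF L2_on_square_integrable[OF g] L2_on_square_integrable[OF u] lim])
  ultimately show "norm_sq (fourier_integral u) = norm_sq u"
    unfolding iso by (rule LIMSEQ_unique)
qed

lemma norm_sq_dominated_convergence:
  assumes [measurable]: "\<And>n::nat. g n \<in> borel_measurable borel" "u \<in> borel_measurable borel"
    and "AE x in lborel. (\<lambda>n. g n x) \<longlonglongrightarrow> u x"
    and "integrable lborel w" "\<And>n. AE x in lborel. (cmod (g n x - u x))\<^sup>2 \<le> w x"
  shows "(\<lambda>n. norm_sq (\<lambda>x. g n x - u x)) \<longlonglongrightarrow> 0"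
proof -
  have "(\<lambda>n. norm_sq (\<lambda>x. g n x - u x)) \<longlonglongrightarrow> integral\<^sup>L lborel (\<lambda>x :: real. 0 :: real)"
    unfolding norm_sq_def
  proof (rule integral_dominated_convergence)
    show "AE x in lborel. (\<lambda>n. (cmod (g n x - u x))\<^sup>2) \<longlonglongrightarrow> 0"
      using assms(3)
    proof eventually_elim
      fix x assume "(\<lambda>n. g n x) \<longlonglongrightarrow> u x"
      then have "(\<lambda>n. (cmod (g n x - u x))\<^sup>2) \<longlonglongrightarrow> (cmod (u x - u x))\<^sup>2"
        by (intro tendsto_intros)
      then show "(\<lambda>n. (cmod (g n x - u x))\<^sup>2) \<longlonglongrightarrow> 0" by simp
    qed
    show "integrable lborel w" by fact
    show "AE x in lborel. norm ((cmod (g n x - u x))\<^sup>2) \<le> w x" for n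
      using assms(5)[of n] by simp
  qed measurable
  then show ?thesis by simp
qed

text \<open>
A measurable function is almost everywhere the limit of continuous functions. Composing these with the
radial retraction onto the disc of radius \<open>M\<close>, which fixes the values of \<open>u\<close>, makes them bounded as well.
\<close>

lemma bounded_ae_limit_of_continuous:
  assumes "u \<in> borel_measurable borel" "\<And>x. cmod (u x) \<le> M" "0 < M"
  obtains p :: "nat \<Rightarrow> real \<Rightarrow> complex" where
    "\<And>n. continuous_on UNIV (p n)" "\<And>n x. cmod (p n x) \<le> M"
    "AE x in lborel. (\<lambda>n. p n x) \<longlonglongrightarrow> u x"
proof -
  have "u \<in> borel_measurable lebesgue"
    using assms(1) by (simp add: measurable_completion)
  then have "u measurable_on UNIV"
    by (intro lebesgue_measurable_imp_measurable_on) auto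
  then obtain N g where N: "negligible N" and g: "\<And>n. continuous_on UNIV (g n)"
    "\<And>x. x \<notin> N \<Longrightarrow> (\<lambda>n. g n x) \<longlonglongrightarrow> u x"
    unfolding measurable_on_def by auto
  define clamp where "clamp z = complex_of_real (M / max M (cmod z)) * z" for z
  have clamp_cont: "continuous_on UNIV clamp"
    unfolding clamp_def using assms(3) by (intro continuous_intros) auto
  show ?thesis
  proof
    show "continuous_on UNIV (\<lambda>x. clamp (g n x))" for n
      using continuous_on_compose2[OF clamp_cont g(1)] by simp
    show "cmod (clamp z) \<le> M" for z
      using assms(3) by (cases "cmod z \<le> M") (auto simp: clamp_def norm_mult norm_divide max_def)
    have "AE x in lebesgue. x \<notin> N"
      using N by (intro AE_not_in) (simp add: negligible_iff_null_sets)
    then have "AE x in lborel. x \<notin> N"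
      by (simp only: AE_completion_iff)
    then show "AE x in lborel. (\<lambda>n. clamp (g n x)) \<longlonglongrightarrow> u x"
    proof eventually_elim
      fix x assume "x \<notin> N"
      then have "(\<lambda>n. clamp (g n x)) \<longlonglongrightarrow> clamp (u x)"
        using continuous_on_tendsto_compose[OF clamp_cont g(2)] by simp
      moreover have "clamp (u x) = u x"
        using assms(2)[of x] assms(3) by (simp add: clamp_def max_def)
      ultimately show "(\<lambda>n. clamp (g n x)) \<longlonglongrightarrow> u x" by simp
    qed
  qed
qed

text \<open>
Cutting the continuous approximants off outside the interval keeps them continuous except at the two end
points, which is why \<open>plancherel_continuous\<close> asks for continuity almost everywhere only.
\<close>

lemma plancherel_bounded:
  assumes u: "u \<in> L2_on L" and "0 \<le> L" and M: "\<And>x. cmod (u x) \<le> M"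
  shows "square_integrable (fourier_integral u)" "norm_sq (fourier_integral u) = norm_sq u"
proof -
  have [measurable]: "u \<in> borel_measurable borel" using u by (simp add: L2_on_measurable)
  have supp: "AE x in lborel. x \<notin> {0<..<L} \<longrightarrow> u x = 0" using u by (simp add: L2_on_def)
  define M' where "M' = max M 1"
  have M': "0 < M'" "\<And>x. cmod (u x) \<le> M'" using M by (auto simp: M'_def le_max_iff_disj)
  obtain p where p: "\<And>n. continuous_on UNIV (p n)" "\<And>n x. cmod (p n x) \<le> M'"
    "AE x in lborel. (\<lambda>n. p n x) \<longlonglongrightarrow> u x"
    using bounded_ae_limit_of_continuous[OF \<open>u \<in> borel_measurable borel\<close> M'(2,1)] by blast
  have [measurable]: "p n \<in> borel_measurable borel" for n
    using p(1) by (rule borel_measurable_continuous_onI)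
  define g where "g n x = (if x \<in> {0<..<L} then p n x else 0)" for n x
  have [measurable]: "g n \<in> borel_measurable borel" for n unfolding g_def by measurable
  have gM: "cmod (g n x) \<le> M'" for n x using p(2) M'(1) by (simp add: g_def)
  have cont: "AE x in lborel. isCont (g n) x" for n
    using AE_lborel_singleton[of 0] AE_lborel_singleton[of L]
  proof eventually_elim
    fix x :: real assume "x \<noteq> 0" "x \<noteq> L"
    then consider "x \<in> {0<..<L}" | "x \<in> {..<0} \<union> {L<..}" using \<open>0 \<le> L\<close> by fastforce
    then show "isCont (g n) x"
    proof cases
      case 1
      then have "\<forall>\<^sub>F y in nhds x. y \<in> {0<..<L}" by (intro eventually_nhds_in_open) auto
      then have "\<forall>\<^sub>F y in nhds x. g n y = p n y" by eventually_elim (simp add: g_def)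
      then show ?thesis
        using p(1)[of n] by (simp add: isCont_cong continuous_on_eq_continuous_at)
    next
      case 2
      then have "\<forall>\<^sub>F y in nhds x. y \<in> {..<0} \<union> {L<..}" by (intro eventually_nhds_in_open) auto
      then have "\<forall>\<^sub>F y in nhds x. g n y = 0" by eventually_elim (auto simp: g_def)
      then show ?thesis by (simp add: isCont_cong)
    qed
  qed
  have ind: "integrable lborel (\<lambda>x. c * indicator {0<..<L} x :: real)" for c
    by (intro integrable_mult_right integrable_indicator_Ioo)
  have g_int: "integrable lborel (g n)" for n
    by (rule Bochner_Integration.integrable_bound[OF ind[of M']])
      (use p(2) M'(1) in \<open>auto simp: g_def\<close>)
  have gd_int: "integrable lborel (\<lambda>x. g n x - g m x)" for n m
    using g_int by (rule Bochner_Integration.integrable_diff) (rule g_int)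
  have gdM: "cmod (g n x - g m x) \<le> 2 * M'" for n m x
    using norm_triangle_ineq4[of "g n x" "g m x"] gM[of n x] gM[of m x] by linarith
  have gd_cont: "AE x in lborel. isCont (\<lambda>x. g n x - g m x) x" for n m
    using cont[of n] cont[of m] by eventually_elim (intro continuous_intros)
  note P = plancherel_continuous[OF g_int gM cont]
  have gL: "g n \<in> L2_on L" for n
    using P(1)[of n] by (simp add: L2_on_def g_def)
  have lim: "(\<lambda>n. norm_sq (\<lambda>x. g n x - u x)) \<longlonglongrightarrow> 0"
  proof (rule norm_sq_dominated_convergence[where w = "\<lambda>x. (2 * M')\<^sup>2 * indicator {0<..<L} x"])
    show "AE x in lborel. (\<lambda>n. g n x) \<longlonglongrightarrow> u x"
      using p(3) supp
    proof eventually_elim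
      fix x assume "(\<lambda>n. p n x) \<longlonglongrightarrow> u x" "x \<notin> {0<..<L} \<longrightarrow> u x = 0"
      then show "(\<lambda>n. g n x) \<longlonglongrightarrow> u x"
        unfolding g_def by (cases "x \<in> {0<..<L}") (simp_all only: if_True if_False simp_thms tendsto_const)
    qed
    show "AE x in lborel. (cmod (g n x - u x))\<^sup>2 \<le> (2 * M')\<^sup>2 * indicator {0<..<L} x" for n
      using supp
    proof eventually_elim
      fix x assume x: "x \<notin> {0<..<L} \<longrightarrow> u x = 0"
      have "cmod (g n x - u x) \<le> 2 * M'"
        using norm_triangle_ineq4[of "g n x" "u x"] gM[of n x] M'(2)[of x] by linarith
      then have "(cmod (g n x - u x))\<^sup>2 \<le> (2 * M')\<^sup>2" by (rule power_mono) simp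
      with x show "(cmod (g n x - u x))\<^sup>2 \<le> (2 * M')\<^sup>2 * indicator {0<..<L} x"
        by (cases "x \<in> {0<..<L}") (auto simp: g_def)
    qed
  qed (use ind in auto)
  show "square_integrable (fourier_integral u)" "norm_sq (fourier_integral u) = norm_sq u"
    using plancherel_L2_limit[OF gL u \<open>0 \<le> L\<close> lim P(2,3) plancherel_continuous(3)[OF gd_int gdM gd_cont]]
    by auto
qed

text \<open>
Truncating the values of \<open>u\<close> at height \<open>n\<close> reduces the identity to bounded functions.
\<close>

theorem plancherel:
  assumes u: "u \<in> L2_on L" and "0 \<le> L"
  shows "square_integrable (fourier_integral u)" "norm_sq (fourier_integral u) = norm_sq u"
proof -
  have [measurable]: "u \<in> borel_measurable borel" using u by (simp add: L2_on_measurable)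
  have supp: "AE x in lborel. x \<notin> {0<..<L} \<longrightarrow> u x = 0" and i: "integrable lborel (\<lambda>x. (cmod (u x))\<^sup>2)"
    using u by (simp_all add: L2_on_def square_integrable_def)
  define g where "g n x = (if cmod (u x) \<le> real n then u x else 0)" for n x
  have [measurable]: "g n \<in> borel_measurable borel" for n unfolding g_def by measurable
  have gL: "g n \<in> L2_on L" for n
  proof -
    have "integrable lborel (\<lambda>x. (cmod (g n x))\<^sup>2)"
      by (rule Bochner_Integration.integrable_bound[OF i]) (auto simp: g_def)
    moreover have "AE x in lborel. x \<notin> {0<..<L} \<longrightarrow> g n x = 0"
      using supp by eventually_elim (simp add: g_def)
    ultimately show ?thesis by (simp add: L2_on_def square_integrable_def)
  qed
  have gM: "cmod (g n x) \<le> real n" for n x by (simp add: g_def)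
  have gdM: "cmod (g n x - g m x) \<le> real n + real m" for n m x
    using norm_triangle_ineq4[of "g n x" "g m x"] gM[of n x] gM[of m x] by linarith
  have lim: "(\<lambda>n. norm_sq (\<lambda>x. g n x - u x)) \<longlonglongrightarrow> 0"
  proof (rule norm_sq_dominated_convergence[OF _ _ _ i])
    show "AE x in lborel. (\<lambda>n. g n x) \<longlonglongrightarrow> u x"
    proof (intro AE_I2 tendsto_eventually)
      fix x
      show "\<forall>\<^sub>F n in sequentially. g n x = u x"
        using eventually_ge_at_top[of "nat \<lceil>cmod (u x)\<rceil>"]
        by eventually_elim (auto simp: g_def nat_ceiling_le_eq)
    qed
    show "AE x in lborel. (cmod (g n x - u x))\<^sup>2 \<le> (cmod (u x))\<^sup>2" for n
      by (intro AE_I2) (simp add: g_def)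
  qed measurable
  note P = plancherel_bounded[OF gL \<open>0 \<le> L\<close> gM]
  show "square_integrable (fourier_integral u)" "norm_sq (fourier_integral u) = norm_sq u"
    using plancherel_L2_limit[OF gL u \<open>0 \<le> L\<close> lim P plancherel_bounded(2)[OF L2_on_diff[OF gL gL] \<open>0 \<le> L\<close> gdM]]
    by auto
qed

section \<open>The fractional form in terms of Fourier integrals\<close>

text \<open>
Once \<open>R \<ge> L\<close>, the truncation no longer affects a function supported in the interval; hence its transform
in the sense of the limit in the mean is almost everywhere the Fourier integral.
\<close>

lemma truncated_fourier_eq:
  assumes u: "u \<in> L2_on L" and "L \<le> R" "0 \<le> L"
  shows "truncated_fourier R u \<xi> = fourier_integral u \<xi>"
proof -
  have [measurable]: "u \<in> borel_measurable borel" and supp: "AE x in lborel. x \<notin> {0<..<L} \<longrightarrow> u x = 0"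
    using u by (auto simp: L2_on_def square_integrable_def)
  have "(LINT x:{-R..R}|lborel. u x * exp (- (\<i> * complex_of_real (x * \<xi>))))
      = (LINT x|lborel. u x * exp (- (\<i> * complex_of_real (x * \<xi>))))"
    unfolding set_lebesgue_integral_def
  proof (rule integral_cong_AE)
    show "AE x in lborel. indicator {-R..R} x *\<^sub>R (u x * exp (- (\<i> * complex_of_real (x * \<xi>))))
        = u x * exp (- (\<i> * complex_of_real (x * \<xi>)))"
      using supp
    proof eventually_elim
      fix x assume x: "x \<notin> {0<..<L} \<longrightarrow> u x = 0"
      show "indicator {-R..R} x *\<^sub>R (u x * exp (- (\<i> * complex_of_real (x * \<xi>))))
        = u x * exp (- (\<i> * complex_of_real (x * \<xi>)))"
      proof (cases "x \<in> {0<..<L}")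
        case True
        then have "x \<in> {-R..R}" using assms(2,3) by auto
        then show ?thesis by simp
      next
        case False
        with x have "u x = 0" by blast
        then show ?thesis by simp
      qed
    qed
  qed measurable
  then show ?thesis by (simp add: truncated_fourier_def fourier_integral_def)
qed

lemma fourier_eq_fourier_integral:
  assumes u: "u \<in> L2_on L" and "0 \<le> L"
  shows "fourier u \<in> borel_measurable borel" "AE \<xi> in lborel. fourier u \<xi> = fourier_integral u \<xi>"
proof -
  have trunc: "\<forall>\<^sub>F R in at_top. truncated_fourier R u = fourier_integral u"
    using eventually_ge_at_top[of L]
    by eventually_elim (simp add: fun_eq_iff truncated_fourier_eq[OF u _ \<open>0 \<le> L\<close>])
  have "is_fourier u (fourier_integral u)"
    unfolding is_fourier_def
  proof
    show "square_integrable (fourier_integral u)" by (rule plancherel(1)[OF assms])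
    show "((\<lambda>R. \<integral>\<^sup>+\<xi>. ennreal ((cmod (truncated_fourier R u \<xi> - fourier_integral u \<xi>))\<^sup>2) \<partial>lborel) \<longlongrightarrow> 0) at_top"
      by (rule tendsto_eventually) (use trunc in \<open>eventually_elim, simp\<close>)
  qed
  then have "is_fourier u (fourier u)"
    unfolding fourier_def by (rule someI[of "is_fourier u"])
  then have sq: "square_integrable (fourier u)"
    and lim: "((\<lambda>R. \<integral>\<^sup>+\<xi>. ennreal ((cmod (truncated_fourier R u \<xi> - fourier u \<xi>))\<^sup>2) \<partial>lborel) \<longlongrightarrow> 0) at_top"
    by (auto simp: is_fourier_def)
  show [measurable]: "fourier u \<in> borel_measurable borel"
    using sq by (simp add: square_integrable_def)
  have [measurable]: "u \<in> borel_measurable borel" using u by (rule L2_on_measurable)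
  let ?c = "\<integral>\<^sup>+\<xi>. ennreal ((cmod (fourier_integral u \<xi> - fourier u \<xi>))\<^sup>2) \<partial>lborel"
  have "((\<lambda>R. \<integral>\<^sup>+\<xi>. ennreal ((cmod (truncated_fourier R u \<xi> - fourier u \<xi>))\<^sup>2) \<partial>lborel) \<longlongrightarrow> ?c) at_top"
    by (rule tendsto_eventually) (use trunc in \<open>eventually_elim, simp\<close>)
  then have "?c = 0"
    using tendsto_unique[OF _ _ lim] by simp
  then have "AE \<xi> in lborel. ennreal ((cmod (fourier_integral u \<xi> - fourier u \<xi>))\<^sup>2) = 0"
    by (subst (asm) nn_integral_0_iff_AE) auto
  then show "AE \<xi> in lborel. fourier u \<xi> = fourier_integral u \<xi>"
    by eventually_elim simp
qed

text \<open>
On the Fourier side this is the fractional Laplacian of order \<open>\<alpha> / 2\<close>, so that the fractional form becomes an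
ordinary inner product, and Cauchy-Schwarz and Fatou's lemma are available for it.
\<close>

definition weighted_transform :: "real \<Rightarrow> (real \<Rightarrow> complex) \<Rightarrow> real \<Rightarrow> complex" where
  "weighted_transform \<alpha> u \<xi> = complex_of_real (\<bar>\<xi>\<bar> powr (\<alpha> / 2)) * fourier_integral u \<xi>"

definition energy_space :: "real \<Rightarrow> real \<Rightarrow> (real \<Rightarrow> complex) set" where
  "energy_space L \<alpha> = {u \<in> L2_on L. square_integrable (weighted_transform \<alpha> u)}"

lemma weighted_transform_measurable [measurable]:
  "u \<in> borel_measurable borel \<Longrightarrow> weighted_transform \<alpha> u \<in> borel_measurable borel"
  unfolding weighted_transform_def by measurable

lemma weighted_transform_square:
  "(cmod (weighted_transform \<alpha> u \<xi>))\<^sup>2 = \<bar>\<xi>\<bar> powr \<alpha> * (cmod (fourier_integral u \<xi>))\<^sup>2"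
proof -
  have "(\<bar>\<xi>\<bar> powr (\<alpha> / 2))\<^sup>2 = \<bar>\<xi>\<bar> powr \<alpha>"
    by (simp add: power2_eq_square powr_add[symmetric])
  then show ?thesis
    by (simp add: weighted_transform_def norm_mult power_mult_distrib)
qed

lemma weighted_transform_lin:
  assumes "u \<in> L2_on L" "v \<in> L2_on L"
  shows "weighted_transform \<alpha> (\<lambda>x. u x + c * v x) = (\<lambda>\<xi>. weighted_transform \<alpha> u \<xi> + c * weighted_transform \<alpha> v \<xi>)"
  by (simp add: fun_eq_iff weighted_transform_def fourier_integral_lin L2_on_integrable[OF assms(1)]
      L2_on_integrable[OF assms(2)] algebra_simps)

text \<open>
These estimates exchange the Sobolev weight for the symbol of the fractional Laplacian: together with
Plancherel's identity they show that finite energy is the same as membership in the Sobolev space.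
\<close>

lemma symbol_bounds:
  fixes \<xi> \<alpha> :: real
  assumes "0 < \<alpha>"
  shows "\<bar>\<xi>\<bar> powr \<alpha> \<le> (1 + \<xi>\<^sup>2) powr (\<alpha> / 2)"
    and "(1 + \<xi>\<^sup>2) powr (\<alpha> / 2) \<le> 2 powr (\<alpha> / 2) * (1 + \<bar>\<xi>\<bar> powr \<alpha>)"
proof -
  have eq: "\<bar>\<xi>\<bar> powr \<alpha> = (\<xi>\<^sup>2) powr (\<alpha> / 2)"
    using powr_powr[of "\<bar>\<xi>\<bar>" 2 "\<alpha> / 2"] by simp
  show "\<bar>\<xi>\<bar> powr \<alpha> \<le> (1 + \<xi>\<^sup>2) powr (\<alpha> / 2)"
    unfolding eq using assms by (intro powr_mono2) auto
  have "(1 + \<xi>\<^sup>2) powr (\<alpha> / 2) \<le> (2 * max 1 (\<xi>\<^sup>2)) powr (\<alpha> / 2)"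
    using assms by (intro powr_mono2) auto
  also have "\<dots> = 2 powr (\<alpha> / 2) * (max 1 (\<xi>\<^sup>2)) powr (\<alpha> / 2)"
    by (simp add: powr_mult)
  also have "(max 1 (\<xi>\<^sup>2)) powr (\<alpha> / 2) \<le> 1 + \<bar>\<xi>\<bar> powr \<alpha>"
    unfolding eq by (auto simp: max_def)
  finally show "(1 + \<xi>\<^sup>2) powr (\<alpha> / 2) \<le> 2 powr (\<alpha> / 2) * (1 + \<bar>\<xi>\<bar> powr \<alpha>)"
    by simp
qed

lemma sobolev0_eq_energy_space:
  assumes "0 < L" "0 < \<alpha>"
  shows "sobolev0 {0<..<L} (\<alpha> / 2) = energy_space L \<alpha>"
proof -
  have "integrable lborel (\<lambda>\<xi>. (1 + \<xi>\<^sup>2) powr (\<alpha> / 2) * (cmod (fourier u \<xi>))\<^sup>2)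
      \<longleftrightarrow> square_integrable (weighted_transform \<alpha> u)" (is "?A \<longleftrightarrow> ?B") if u: "u \<in> L2_on L" for u
  proof -
    have [measurable]: "u \<in> borel_measurable borel" using u by (rule L2_on_measurable)
    note [measurable] = fourier_eq_fourier_integral(1)[OF u less_imp_le[OF assms(1)]]
    have "?A \<longleftrightarrow> integrable lborel (\<lambda>\<xi>. (1 + \<xi>\<^sup>2) powr (\<alpha> / 2) * (cmod (fourier_integral u \<xi>))\<^sup>2)"
    proof (rule integrable_cong_AE)
      show "AE \<xi> in lborel. (1 + \<xi>\<^sup>2) powr (\<alpha> / 2) * (cmod (fourier u \<xi>))\<^sup>2
          = (1 + \<xi>\<^sup>2) powr (\<alpha> / 2) * (cmod (fourier_integral u \<xi>))\<^sup>2"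
        using fourier_eq_fourier_integral(2)[OF u less_imp_le[OF assms(1)]] by eventually_elim simp
    qed measurable
    also have "\<dots> \<longleftrightarrow> integrable lborel (\<lambda>\<xi>. \<bar>\<xi>\<bar> powr \<alpha> * (cmod (fourier_integral u \<xi>))\<^sup>2)"
    proof
      assume "integrable lborel (\<lambda>\<xi>. (1 + \<xi>\<^sup>2) powr (\<alpha> / 2) * (cmod (fourier_integral u \<xi>))\<^sup>2)"
      then show "integrable lborel (\<lambda>\<xi>. \<bar>\<xi>\<bar> powr \<alpha> * (cmod (fourier_integral u \<xi>))\<^sup>2)"
        by (rule Bochner_Integration.integrable_bound)
          (use symbol_bounds(1)[OF assms(2)] in \<open>auto simp: abs_mult intro!: mult_right_mono\<close>)
    next
      assume i: "integrable lborel (\<lambda>\<xi>. \<bar>\<xi>\<bar> powr \<alpha> * (cmod (fourier_integral u \<xi>))\<^sup>2)"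
      have "integrable lborel (\<lambda>\<xi>. (cmod (fourier_integral u \<xi>))\<^sup>2)"
        using plancherel(1)[OF u] assms(1) by (simp add: square_integrable_def)
      then have "integrable lborel (\<lambda>\<xi>. 2 powr (\<alpha> / 2) * ((cmod (fourier_integral u \<xi>))\<^sup>2
          + \<bar>\<xi>\<bar> powr \<alpha> * (cmod (fourier_integral u \<xi>))\<^sup>2))"
        using i by (intro integrable_mult_right Bochner_Integration.integrable_add)
      then show "integrable lborel (\<lambda>\<xi>. (1 + \<xi>\<^sup>2) powr (\<alpha> / 2) * (cmod (fourier_integral u \<xi>))\<^sup>2)"
      proof (rule Bochner_Integration.integrable_bound)
        have "(1 + \<xi>\<^sup>2) powr (\<alpha> / 2) * (cmod (fourier_integral u \<xi>))\<^sup>2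
            \<le> 2 powr (\<alpha> / 2) * (1 + \<bar>\<xi>\<bar> powr \<alpha>) * (cmod (fourier_integral u \<xi>))\<^sup>2" for \<xi>
          by (intro mult_right_mono symbol_bounds assms) simp
        then show "AE \<xi> in lborel. norm ((1 + \<xi>\<^sup>2) powr (\<alpha> / 2) * (cmod (fourier_integral u \<xi>))\<^sup>2)
            \<le> norm (2 powr (\<alpha> / 2) * ((cmod (fourier_integral u \<xi>))\<^sup>2 + \<bar>\<xi>\<bar> powr \<alpha> * (cmod (fourier_integral u \<xi>))\<^sup>2))"
          by (intro AE_I2) (simp add: abs_mult algebra_simps)
      qed measurable
    qed
    also have "\<dots> \<longleftrightarrow> ?B"
      by (simp add: square_integrable_def weighted_transform_square)
    finally show ?thesis .
  qed
  then show ?thesis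
    by (auto simp: sobolev0_def sobolev_def energy_space_def L2_on_def)
qed

lemma frac_form_eq:
  assumes u: "u \<in> L2_on L" and v: "v \<in> L2_on L" and "0 \<le> L"
  shows "frac_form \<alpha> u v = L2_inner (weighted_transform \<alpha> u) (weighted_transform \<alpha> v)"
  unfolding frac_form_def L2_inner_def
proof (rule integral_cong_AE)
  note [measurable] = fourier_eq_fourier_integral(1)[OF u \<open>0 \<le> L\<close>] fourier_eq_fourier_integral(1)[OF v \<open>0 \<le> L\<close>]
    L2_on_measurable[OF u] L2_on_measurable[OF v]
  show "AE \<xi> in lborel. complex_of_real (\<bar>\<xi>\<bar> powr \<alpha>) * (fourier u \<xi> * cnj (fourier v \<xi>))
      = weighted_transform \<alpha> u \<xi> * cnj (weighted_transform \<alpha> v \<xi>)"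
    using fourier_eq_fourier_integral(2)[OF u \<open>0 \<le> L\<close>] fourier_eq_fourier_integral(2)[OF v \<open>0 \<le> L\<close>]
  proof eventually_elim
    fix \<xi> assume "fourier u \<xi> = fourier_integral u \<xi>" "fourier v \<xi> = fourier_integral v \<xi>"
    moreover have "complex_of_real (\<bar>\<xi>\<bar> powr \<alpha>)
        = complex_of_real (\<bar>\<xi>\<bar> powr (\<alpha> / 2)) * complex_of_real (\<bar>\<xi>\<bar> powr (\<alpha> / 2))"
      unfolding of_real_mult[symmetric] powr_add[symmetric] by simp
    ultimately show "complex_of_real (\<bar>\<xi>\<bar> powr \<alpha>) * (fourier u \<xi> * cnj (fourier v \<xi>))
      = weighted_transform \<alpha> u \<xi> * cnj (weighted_transform \<alpha> v \<xi>)"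
      by (simp add: weighted_transform_def mult_ac)
  qed
  show "(\<lambda>\<xi>. complex_of_real (\<bar>\<xi>\<bar> powr \<alpha>) * (fourier u \<xi> * cnj (fourier v \<xi>))) \<in> borel_measurable lborel"
    "(\<lambda>\<xi>. weighted_transform \<alpha> u \<xi> * cnj (weighted_transform \<alpha> v \<xi>)) \<in> borel_measurable lborel"
    by measurable
qed

section \<open>Compactness of the embedding\<close>

text \<open>
A Cauchy sequence in the mean is Cauchy in \<open>L\<^sup>1\<close> because the interval is bounded. Hence some subsequence
converges almost everywhere, and Fatou's lemma bounds the distance to its limit.
\<close>

lemma L2_on_complete:
  assumes f: "\<And>n::nat. f n \<in> L2_on L" and "0 \<le> L"
    and cauchy: "\<And>e. 0 < e \<Longrightarrow> \<exists>N. \<forall>i\<ge>N. \<forall>j\<ge>N. norm_sq (\<lambda>x. f i x - f j x) \<le> e"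
  shows "\<exists>u\<in>L2_on L. (\<lambda>n. norm_sq (\<lambda>x. f n x - u x)) \<longlonglongrightarrow> 0"
proof -
  note [measurable] = L2_on_measurable[OF f]
  have "\<exists>N. \<forall>i\<ge>N. \<forall>j\<ge>N. (LINT x|lborel. norm (f i x - f j x)) < e" if "0 < e" for e
  proof -
    have "0 < e\<^sup>2 / (L + 1)" using that \<open>0 \<le> L\<close> by simp
    from cauchy[OF this] obtain N where N: "norm_sq (\<lambda>x. f i x - f j x) \<le> e\<^sup>2 / (L + 1)" if "N \<le> i" "N \<le> j" for i j
      by blast
    have "(LINT x|lborel. norm (f i x - f j x)) < e" if "N \<le> i" "N \<le> j" for i j
    proof -
      have "(LINT x|lborel. norm (f i x - f j x))\<^sup>2 \<le> L * norm_sq (\<lambda>x. f i x - f j x)"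
        by (rule L1_le_L2[OF L2_on_diff[OF f f] \<open>0 \<le> L\<close>])
      also have "\<dots> \<le> L * (e\<^sup>2 / (L + 1))"
        using N[OF that] \<open>0 \<le> L\<close> by (rule mult_left_mono)
      also have "\<dots> < e\<^sup>2" using \<open>0 < e\<close> \<open>0 \<le> L\<close> by (simp add: field_simps)
      finally show ?thesis using \<open>0 < e\<close> by (simp add: power2_less_imp_less)
    qed
    then show ?thesis by blast
  qed
  then obtain r where r: "strict_mono r" "AE x in lborel. Cauchy (\<lambda>i. f (r i) x)"
    using cauchy_L1_AE_cauchy_subseq[of lborel f] L2_on_integrable[OF f] by blast
  define u where "u x = lim (\<lambda>i. f (r i) x)" for x
  have [measurable]: "u \<in> borel_measurable borel" unfolding u_def by measurable
  have lim: "AE x in lborel. (\<lambda>i. f (r i) x) \<longlonglongrightarrow> u x"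
    using r(2) by eventually_elim (simp add: u_def Cauchy_convergent_iff convergent_LIMSEQ_iff)
  have close: "\<exists>N. \<forall>n\<ge>N. square_integrable (\<lambda>x. f n x - u x) \<and> norm_sq (\<lambda>x. f n x - u x) \<le> e" if "0 < e" for e
  proof -
    obtain N where N: "norm_sq (\<lambda>x. f i x - f j x) \<le> e" if "N \<le> i" "N \<le> j" for i j
      using cauchy[OF \<open>0 < e\<close>] by blast
    have "square_integrable (\<lambda>x. f n x - u x) \<and> norm_sq (\<lambda>x. f n x - u x) \<le> e" if "N \<le> n" for n
    proof -
      have "\<forall>\<^sub>F i in sequentially. norm_sq (\<lambda>x. f n x - f (r i) x) \<le> e"
        using eventually_ge_at_top[of N]
        by eventually_elim (intro N \<open>N \<le> n\<close>, meson r(1) order_trans seq_suble)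
      moreover have "AE x in lborel. (\<lambda>i. f n x - f (r i) x) \<longlonglongrightarrow> f n x - u x"
        using lim by eventually_elim (intro tendsto_intros)
      ultimately show ?thesis
        using norm_sq_fatou[of "\<lambda>x. f n x - u x" "\<lambda>i x. f n x - f (r i) x" e]
          L2_on_square_integrable[OF L2_on_diff[OF f f]] by simp
    qed
    then show ?thesis by blast
  qed
  obtain N where "square_integrable (\<lambda>x. f N x - u x)"
    using close[of 1] by auto
  then have "square_integrable (\<lambda>x. f N x - (f N x - u x))"
    by (rule square_integrable_diff[OF L2_on_square_integrable[OF f]])
  then have sq: "square_integrable u" by simp
  have "AE x in lborel. \<forall>i. x \<notin> {0<..<L} \<longrightarrow> f (r i) x = 0"
    unfolding AE_all_countable using f by (simp add: L2_on_def)
  with lim have "AE x in lborel. x \<notin> {0<..<L} \<longrightarrow> u x = 0"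
  proof eventually_elim
    fix x assume *: "(\<lambda>i. f (r i) x) \<longlonglongrightarrow> u x" "\<forall>i. x \<notin> {0<..<L} \<longrightarrow> f (r i) x = 0"
    show "x \<notin> {0<..<L} \<longrightarrow> u x = 0"
    proof
      assume "x \<notin> {0<..<L}"
      then have "(\<lambda>i. f (r i) x) = (\<lambda>_. 0)" using *(2) by blast
      then show "u x = 0" using *(1) by (simp add: LIMSEQ_const_iff)
    qed
  qed
  with sq have "u \<in> L2_on L" by (simp add: L2_on_def)
  moreover have "(\<lambda>n. norm_sq (\<lambda>x. f n x - u x)) \<longlonglongrightarrow> 0"
  proof (rule LIMSEQ_I)
    fix e :: real assume "0 < e"
    then obtain N where "\<forall>n\<ge>N. norm_sq (\<lambda>x. f n x - u x) \<le> e / 2"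
      using close[of "e / 2"] by auto
    then show "\<exists>N. \<forall>n\<ge>N. norm (norm_sq (\<lambda>x. f n x - u x) - 0) < e"
      using \<open>0 < e\<close> by (intro exI[of _ N]) (auto simp: abs_of_nonneg[OF norm_sq_nonneg] intro: le_less_trans)
  qed
  ultimately show ?thesis by blast
qed

text \<open>
The kernel has \<open>\<xi>\<close>-derivative of modulus \<open>\<bar>x\<bar> \<le> L\<close> on the interval.
\<close>

lemma fourier_integral_lipschitz:
  assumes u: "u \<in> L2_on L" and "0 \<le> L"
  shows "cmod (fourier_integral u \<xi> - fourier_integral u \<eta>) \<le> L * sqrt (L * norm_sq u) * \<bar>\<xi> - \<eta>\<bar>"
proof -
  have [measurable]: "u \<in> borel_measurable borel" and supp: "AE x in lborel. x \<notin> {0<..<L} \<longrightarrow> u x = 0"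
    using u by (auto simp: L2_on_def square_integrable_def)
  note i = L2_on_integrable[OF u]
  let ?k = "\<lambda>x \<xi>. exp (- (\<i> * complex_of_real (x * \<xi>)))"
  have kernel: "cmod (?k x \<xi> - ?k x \<eta>) \<le> \<bar>x\<bar> * \<bar>\<xi> - \<eta>\<bar>" for x
  proof -
    have "?k x \<xi> - ?k x \<eta> = ?k x \<eta> * (iexp (x * (\<eta> - \<xi>)) - 1)"
      by (simp add: algebra_simps exp_add[symmetric] exp_diff[symmetric])
    then have "cmod (?k x \<xi> - ?k x \<eta>) = cmod (iexp (x * (\<eta> - \<xi>)) - 1)"
      by (simp only: norm_mult norm_kernel mult_1_left)
    also have "\<dots> \<le> \<bar>x * (\<eta> - \<xi>)\<bar>"
      using iexp_approx1[of "x * (\<eta> - \<xi>)" 0] by simp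
    also have "\<dots> = \<bar>x\<bar> * \<bar>\<xi> - \<eta>\<bar>" by (simp add: abs_mult abs_minus_commute)
    finally show ?thesis .
  qed
  have "fourier_integral u \<xi> - fourier_integral u \<eta> = (LINT x|lborel. u x * ?k x \<xi> - u x * ?k x \<eta>) / sqrt (2 * pi)"
    using integrable_kernel[OF i, of \<xi>] integrable_kernel[OF i, of \<eta>]
    by (simp add: fourier_integral_def diff_divide_distrib del: of_real_mult)
  then have "cmod (fourier_integral u \<xi> - fourier_integral u \<eta>)
      = cmod (LINT x|lborel. u x * ?k x \<xi> - u x * ?k x \<eta>) / sqrt (2 * pi)"
    by (simp add: norm_divide del: of_real_mult)
  \<comment> \<open>The normalising factor is dropped, as only the uniformity of the Lipschitz constant matters.\<close>
  also have "\<dots> \<le> cmod (LINT x|lborel. u x * ?k x \<xi> - u x * ?k x \<eta>) / 1"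
  proof (rule divide_left_mono)
    have "1\<^sup>2 \<le> 2 * pi" using pi_ge_two by simp
    then show "1 \<le> sqrt (2 * pi)" by (rule real_le_rsqrt)
  qed auto
  also have "\<dots> \<le> (LINT x|lborel. cmod (u x * ?k x \<xi> - u x * ?k x \<eta>))"
    unfolding div_by_1 by (rule integral_norm_bound)
  also have "\<dots> \<le> (LINT x|lborel. L * \<bar>\<xi> - \<eta>\<bar> * cmod (u x))"
  proof (rule integral_mono_AE)
    show "integrable lborel (\<lambda>x. cmod (u x * ?k x \<xi> - u x * ?k x \<eta>))"
      by (intro integrable_norm Bochner_Integration.integrable_diff integrable_kernel i)
    show "integrable lborel (\<lambda>x. L * \<bar>\<xi> - \<eta>\<bar> * cmod (u x))"
      by (intro integrable_mult_right integrable_norm i)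
    show "AE x in lborel. cmod (u x * ?k x \<xi> - u x * ?k x \<eta>) \<le> L * \<bar>\<xi> - \<eta>\<bar> * cmod (u x)"
      using supp
    proof eventually_elim
      fix x assume x: "x \<notin> {0<..<L} \<longrightarrow> u x = 0"
      have "cmod (u x * ?k x \<xi> - u x * ?k x \<eta>) = cmod (u x) * cmod (?k x \<xi> - ?k x \<eta>)"
        by (simp only: right_diff_distrib[symmetric] norm_mult)
      also have "\<dots> \<le> cmod (u x) * (L * \<bar>\<xi> - \<eta>\<bar>)"
      proof (cases "x \<in> {0<..<L}")
        case True
        then have "\<bar>x\<bar> * \<bar>\<xi> - \<eta>\<bar> \<le> L * \<bar>\<xi> - \<eta>\<bar>" by (intro mult_right_mono) auto
        then show ?thesis using order_trans[OF kernel] by (intro mult_left_mono) auto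
      next
        case False
        with x have "u x = 0" by blast
        then show ?thesis by simp
      qed
      finally show "cmod (u x * ?k x \<xi> - u x * ?k x \<eta>) \<le> L * \<bar>\<xi> - \<eta>\<bar> * cmod (u x)"
        by (simp add: mult_ac)
    qed
  qed
  also have "\<dots> = L * \<bar>\<xi> - \<eta>\<bar> * (LINT x|lborel. cmod (u x))"
    by (rule integral_mult_right_zero)
  also have "\<dots> \<le> L * \<bar>\<xi> - \<eta>\<bar> * sqrt (L * norm_sq u)"
    using \<open>0 \<le> L\<close> by (intro mult_left_mono real_le_rsqrt L1_le_L2 u) auto
  finally show ?thesis by (simp add: mult_ac)
qed

text \<open>
A diagonal sequence converges at all rational points, and the common Lipschitz constant extends this to
all real points.
\<close>

lemma equilipschitz_convergent_subsequence:
  fixes F :: "nat \<Rightarrow> real \<Rightarrow> complex"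
  assumes bound: "\<And>n x. cmod (F n x) \<le> M" and lip: "\<And>n x y. cmod (F n x - F n y) \<le> C * \<bar>x - y\<bar>"
  shows "\<exists>r g. strict_mono (r :: nat \<Rightarrow> nat) \<and> (\<forall>x. (\<lambda>n. F (r n) x) \<longlonglongrightarrow> g x)"
proof -
  have "\<exists>r :: nat \<Rightarrow> nat. strict_mono r \<and> (\<forall>q\<in>\<rat>. \<exists>l. (\<lambda>n. F (r n) q) \<longlonglongrightarrow> l)"
  proof (rule function_convergent_subsequence[OF countable_rat bound])
    fix r :: "nat \<Rightarrow> nat"
    assume "strict_mono r" "\<And>q. q \<in> \<rat> \<Longrightarrow> \<exists>l. (\<lambda>n. F (r n) q) \<longlonglongrightarrow> l"
    then show ?thesis by blast
  qed
  then obtain r where r: "strict_mono (r :: nat \<Rightarrow> nat)" "\<And>q. q \<in> \<rat> \<Longrightarrow> \<exists>l. (\<lambda>n. F (r n) q) \<longlonglongrightarrow> l"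
    by blast
  have "\<exists>l. (\<lambda>n. F (r n) x) \<longlonglongrightarrow> l" for x
  proof -
    have "Cauchy (\<lambda>n. F (r n) x)"
    proof (rule metric_CauchyI)
      fix e :: real assume "0 < e"
      define c where "c = \<bar>C\<bar> + 1"
      define d where "d = e / (3 * c)"
      have "0 < c" by (simp add: c_def)
      then have "0 < d" using \<open>0 < e\<close> by (simp add: d_def)
      obtain q where q: "q \<in> \<rat>" "x < q" "q < x + d"
        using Rats_dense_in_real[of x "x + d"] \<open>0 < d\<close> by auto
      have near: "dist (F n x) (F n q) < e / 3" for n
      proof -
        have "dist (F n x) (F n q) \<le> C * \<bar>x - q\<bar>" using lip by (simp add: dist_norm)
        also have "\<dots> \<le> \<bar>C\<bar> * d" using q by (intro mult_mono) auto
        also have "\<dots> < c * d" using \<open>0 < d\<close> by (simp add: c_def)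
        also have "\<dots> = e / 3" using \<open>0 < c\<close> by (simp add: d_def)
        finally show ?thesis .
      qed
      have "Cauchy (\<lambda>n. F (r n) q)" using r(2)[OF q(1)] by (auto intro: LIMSEQ_imp_Cauchy)
      then obtain N where N: "\<And>m n. N \<le> m \<Longrightarrow> N \<le> n \<Longrightarrow> dist (F (r m) q) (F (r n) q) < e / 3"
        using metric_CauchyD[of "\<lambda>n. F (r n) q" "e / 3"] \<open>0 < e\<close> by auto
      have "dist (F (r m) x) (F (r n) x) < e" if "N \<le> m" "N \<le> n" for m n
      proof -
        have "dist (F (r m) x) (F (r n) x)
            \<le> dist (F (r m) x) (F (r m) q) + dist (F (r m) q) (F (r n) q) + dist (F (r n) x) (F (r n) q)"
          using dist_triangle[of "F (r m) x" "F (r n) x" "F (r m) q"]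
            dist_triangle2[of "F (r m) q" "F (r n) x" "F (r n) q"] by linarith
        then show ?thesis using near[of "r m"] near[of "r n"] N[OF that] by linarith
      qed
      then show "\<exists>N. \<forall>m\<ge>N. \<forall>n\<ge>N. dist (F (r m) x) (F (r n) x) < e" by blast
    qed
    then show ?thesis by (simp add: Cauchy_convergent_iff convergent_def)
  qed
  then obtain g where "\<forall>x. (\<lambda>n. F (r n) x) \<longlonglongrightarrow> g x" by metis
  with r(1) show ?thesis by blast
qed

lemma fourier_tail_le:
  assumes "0 < R" "0 < \<alpha>"
  shows "(cmod z)\<^sup>2 \<le> indicator {-R..R} \<xi> * (cmod z)\<^sup>2 + R powr (- \<alpha>) * (\<bar>\<xi>\<bar> powr \<alpha> * (cmod z)\<^sup>2)"
proof (cases "\<xi> \<in> {-R..R}")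
  case False
  then have "R powr \<alpha> \<le> \<bar>\<xi>\<bar> powr \<alpha>" using assms by (intro powr_mono2) auto
  then have "R powr (- \<alpha>) * R powr \<alpha> \<le> R powr (- \<alpha>) * \<bar>\<xi>\<bar> powr \<alpha>" by (intro mult_left_mono) auto
  then have "1 * (cmod z)\<^sup>2 \<le> R powr (- \<alpha>) * \<bar>\<xi>\<bar> powr \<alpha> * (cmod z)\<^sup>2"
    using assms by (intro mult_right_mono) (simp_all add: powr_add[symmetric])
  then show ?thesis using False by (simp add: mult.assoc)
qed simp

text \<open>
Let \<open>g\<close> be the pointwise limit of the transforms along a subsequence. On a bounded range of
frequencies the convergence to \<open>g\<close> is dominated. Outside \<open>{-R..R}\<close> the energy bound, which \<open>g\<close> inherits by
Fatou's lemma, makes the contribution of order \<open>R powr (- \<alpha>)\<close>. So the transforms converge in the mean,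
and by Plancherel's identity the functions themselves form a Cauchy sequence.
\<close>

lemma rellich:
  assumes "0 \<le> L" "0 < \<alpha>"
    and f: "\<And>k::nat. f k \<in> energy_space L \<alpha>" and f1: "\<And>k. norm_sq (f k) \<le> 1"
    and f2: "\<And>k. norm_sq (weighted_transform \<alpha> (f k)) \<le> C"
  shows "\<exists>u\<in>L2_on L. \<exists>r::nat \<Rightarrow> nat. strict_mono r \<and> (\<lambda>k. norm_sq (\<lambda>x. f (r k) x - u x)) \<longlonglongrightarrow> 0"
proof -
  have fL: "f k \<in> L2_on L" and fE: "square_integrable (weighted_transform \<alpha> (f k))" for k
    using f[of k] by (simp_all add: energy_space_def)
  note [measurable] = L2_on_measurable[OF fL]
  define M where "M = sqrt (L / (2 * pi))"
  have bound: "cmod (fourier_integral (f k) \<xi>) \<le> M" for k \<xi>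
  proof -
    have "(cmod (fourier_integral (f k) \<xi>))\<^sup>2 \<le> L / (2 * pi) * norm_sq (f k)"
      by (rule fourier_integral_square_le[OF fL \<open>0 \<le> L\<close>])
    also have "\<dots> \<le> L / (2 * pi) * 1" using f1 \<open>0 \<le> L\<close> by (intro mult_left_mono) auto
    finally show ?thesis unfolding M_def by (simp add: real_le_rsqrt)
  qed
  have lip: "cmod (fourier_integral (f k) \<xi> - fourier_integral (f k) \<eta>) \<le> L * sqrt L * \<bar>\<xi> - \<eta>\<bar>" for k \<xi> \<eta>
  proof -
    have "cmod (fourier_integral (f k) \<xi> - fourier_integral (f k) \<eta>) \<le> L * sqrt (L * norm_sq (f k)) * \<bar>\<xi> - \<eta>\<bar>"
      by (rule fourier_integral_lipschitz[OF fL \<open>0 \<le> L\<close>])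
    also have "\<dots> \<le> L * sqrt (L * 1) * \<bar>\<xi> - \<eta>\<bar>"
      using f1[of k] \<open>0 \<le> L\<close> by (intro mult_right_mono mult_left_mono real_sqrt_le_mono) auto
    finally show ?thesis by simp
  qed
  obtain r g where r: "strict_mono (r :: nat \<Rightarrow> nat)" and g: "\<And>\<xi>. (\<lambda>k. fourier_integral (f (r k)) \<xi>) \<longlonglongrightarrow> g \<xi>"
    using equilipschitz_convergent_subsequence[of "\<lambda>k. fourier_integral (f k)", OF bound lip] by blast
  have [measurable]: "g \<in> borel_measurable borel"
    by (rule borel_measurable_LIMSEQ_metric[OF _ g]) measurable
  have gM: "cmod (g \<xi>) \<le> M" for \<xi>
    by (rule LIMSEQ_le_const2[OF tendsto_norm[OF g]]) (use bound in auto)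
  have C: "0 \<le> C" using f2[of 0] norm_sq_nonneg order_trans by blast
  define D where "D k = (\<lambda>\<xi>. fourier_integral (f (r k)) \<xi> - g \<xi>)" for k
  have [measurable]: "D k \<in> borel_measurable borel" for k unfolding D_def by measurable
  define G where "G = (\<lambda>\<xi>. complex_of_real (\<bar>\<xi>\<bar> powr (\<alpha> / 2)) * g \<xi>)"
  have half_lim: "(\<lambda>k. weighted_transform \<alpha> (f (r k)) \<xi>) \<longlonglongrightarrow> G \<xi>" for \<xi>
    unfolding weighted_transform_def G_def by (intro tendsto_intros g)
  have G: "square_integrable G" "norm_sq G \<le> C"
    using norm_sq_fatou[of G "\<lambda>k. weighted_transform \<alpha> (f (r k))" C] fE f2 half_lim
    by (simp_all add: G_def)
  define H where "H k = (\<lambda>\<xi>. weighted_transform \<alpha> (f (r k)) \<xi> - G \<xi>)" for k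
  have H: "square_integrable (H k)" "norm_sq (H k) \<le> 4 * C" for k
    using square_integrable_diff[OF fE G(1)] norm_sq_diff_le[OF fE G(1), of "r k"] f2[of "r k"] G(2)
    by (simp_all add: H_def)
  have HD: "(cmod (H k \<xi>))\<^sup>2 = \<bar>\<xi>\<bar> powr \<alpha> * (cmod (D k \<xi>))\<^sup>2" for k \<xi>
  proof -
    have "H k \<xi> = complex_of_real (\<bar>\<xi>\<bar> powr (\<alpha> / 2)) * D k \<xi>"
      by (simp add: H_def weighted_transform_def G_def D_def algebra_simps)
    moreover have "(\<bar>\<xi>\<bar> powr (\<alpha> / 2))\<^sup>2 = \<bar>\<xi>\<bar> powr \<alpha>"
      by (simp add: power2_eq_square powr_add[symmetric])
    ultimately show ?thesis by (simp add: norm_mult power_mult_distrib)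
  qed
  have DM: "cmod (D k \<xi>) \<le> 2 * M" for k \<xi>
    unfolding D_def using norm_triangle_ineq4[of "fourier_integral (f (r k)) \<xi>" "g \<xi>"] bound[of "r k" \<xi>] gM[of \<xi>]
    by linarith
  have inner_int: "integrable lborel (\<lambda>\<xi>. indicator {-R..R} \<xi> * (2 * M)\<^sup>2)" for R :: real
    by (intro integrable_mult_left integrable_real_indicator) (auto simp: emeasure_lborel_Icc_eq)
  have Dsq_le: "(cmod (D k \<xi>))\<^sup>2 \<le> (2 * M)\<^sup>2" for k \<xi>
    by (intro power_mono DM) simp
  have D_int: "integrable lborel (\<lambda>\<xi>. indicator {-R..R} \<xi> * (cmod (D k \<xi>))\<^sup>2)" for R k
    by (rule Bochner_Integration.integrable_bound[OF inner_int[of R]])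
      (use Dsq_le in \<open>auto simp: abs_mult intro!: mult_left_mono\<close>)
  have local_lim: "(\<lambda>k. LINT \<xi>|lborel. indicator {-R..R} \<xi> * (cmod (D k \<xi>))\<^sup>2) \<longlonglongrightarrow> 0" for R
  proof -
    have "(\<lambda>k. LINT \<xi>|lborel. indicator {-R..R} \<xi> * (cmod (D k \<xi>))\<^sup>2) \<longlonglongrightarrow> integral\<^sup>L lborel (\<lambda>\<xi>::real. 0 :: real)"
    proof (rule integral_dominated_convergence[OF _ _ inner_int[of R]])
      show "AE \<xi> in lborel. (\<lambda>k. indicator {-R..R} \<xi> * (cmod (D k \<xi>))\<^sup>2) \<longlonglongrightarrow> 0"
      proof (rule AE_I2)
        fix \<xi>
        have "(\<lambda>k. indicator {-R..R} \<xi> * (cmod (D k \<xi>))\<^sup>2) \<longlonglongrightarrow> indicator {-R..R} \<xi> * (cmod (g \<xi> - g \<xi>))\<^sup>2"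
          unfolding D_def by (intro tendsto_intros g)
        then show "(\<lambda>k. indicator {-R..R} \<xi> * (cmod (D k \<xi>))\<^sup>2) \<longlonglongrightarrow> 0" by simp
      qed
      show "AE \<xi> in lborel. norm (indicator {-R..R} \<xi> * (cmod (D k \<xi>))\<^sup>2) \<le> indicator {-R..R} \<xi> * (2 * M)\<^sup>2" for k
        using Dsq_le by (auto simp: abs_mult intro!: mult_left_mono)
    qed measurable
    then show ?thesis by simp
  qed
  have D_sq: "square_integrable (D k)"
    and D_le: "0 < R \<Longrightarrow> norm_sq (D k) \<le> (LINT \<xi>|lborel. indicator {-R..R} \<xi> * (cmod (D k \<xi>))\<^sup>2) + R powr (- \<alpha>) * (4 * C)" for k R
  proof -
    have int: "integrable lborel (\<lambda>\<xi>. \<bar>\<xi>\<bar> powr \<alpha> * (cmod (D k \<xi>))\<^sup>2)"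
      using H(1)[of k] by (simp add: square_integrable_def HD)
    have maj: "integrable lborel (\<lambda>\<xi>. indicator {-R..R} \<xi> * (cmod (D k \<xi>))\<^sup>2 + R powr (- \<alpha>) * (\<bar>\<xi>\<bar> powr \<alpha> * (cmod (D k \<xi>))\<^sup>2))" for R
      by (intro Bochner_Integration.integrable_add integrable_mult_right D_int int)
    have sq: "integrable lborel (\<lambda>\<xi>. (cmod (D k \<xi>))\<^sup>2)"
      by (rule Bochner_Integration.integrable_bound[OF maj[of 1]])
        (use fourier_tail_le[of 1 \<alpha>] \<open>0 < \<alpha>\<close> in \<open>auto simp: abs_of_nonneg\<close>)
    then show "square_integrable (D k)" by (simp add: square_integrable_def)
    assume "0 < R"
    have "norm_sq (D k) \<le> (LINT \<xi>|lborel. indicator {-R..R} \<xi> * (cmod (D k \<xi>))\<^sup>2 + R powr (- \<alpha>) * (\<bar>\<xi>\<bar> powr \<alpha> * (cmod (D k \<xi>))\<^sup>2))"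
      unfolding norm_sq_def using sq maj by (rule integral_mono) (rule fourier_tail_le[OF \<open>0 < R\<close> \<open>0 < \<alpha>\<close>])
    also have "\<dots> = (LINT \<xi>|lborel. indicator {-R..R} \<xi> * (cmod (D k \<xi>))\<^sup>2) + R powr (- \<alpha>) * norm_sq (H k)"
      using D_int int by (subst Bochner_Integration.integral_add) (simp_all add: norm_sq_def HD)
    also have "\<dots> \<le> (LINT \<xi>|lborel. indicator {-R..R} \<xi> * (cmod (D k \<xi>))\<^sup>2) + R powr (- \<alpha>) * (4 * C)"
      using H(2) by (intro add_left_mono mult_left_mono) auto
    finally show "norm_sq (D k) \<le> (LINT \<xi>|lborel. indicator {-R..R} \<xi> * (cmod (D k \<xi>))\<^sup>2) + R powr (- \<alpha>) * (4 * C)" .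
  qed
  have D_lim: "(\<lambda>k. norm_sq (D k)) \<longlonglongrightarrow> 0"
  proof (rule LIMSEQ_I)
    fix e :: real assume "0 < e"
    have "((\<lambda>R. R powr (- \<alpha>) * (4 * C)) \<longlongrightarrow> 0) at_top"
      using \<open>0 < \<alpha>\<close> by (intro tendsto_mult_left_zero tendsto_neg_powr filterlim_ident) simp
    then have "\<forall>\<^sub>F R in at_top. R powr (- \<alpha>) * (4 * C) < e / 2"
      using \<open>0 < e\<close> by (intro order_tendstoD) auto
    then obtain R where R: "0 < R" "R powr (- \<alpha>) * (4 * C) < e / 2"
      using eventually_happens'[OF _ eventually_conj[OF eventually_gt_at_top[of "0::real"]]] by (metis trivial_limit_at_top_linorder)
    have "\<forall>\<^sub>F k in sequentially. (LINT \<xi>|lborel. indicator {-R..R} \<xi> * (cmod (D k \<xi>))\<^sup>2) < e / 2"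
      using \<open>0 < e\<close> by (intro order_tendstoD(2)[OF local_lim]) simp
    then have "\<forall>\<^sub>F k in sequentially. norm (norm_sq (D k) - 0) < e"
    proof eventually_elim
      case (elim k)
      then show ?case using D_le[OF R(1), of k] R(2) norm_sq_nonneg[of "D k"] by simp
    qed
    then show "\<exists>N. \<forall>k\<ge>N. norm (norm_sq (D k) - 0) < e" by (simp add: eventually_sequentially)
  qed
  have "\<exists>u\<in>L2_on L. (\<lambda>k. norm_sq (\<lambda>x. f (r k) x - u x)) \<longlonglongrightarrow> 0"
  proof (rule L2_on_complete[OF fL \<open>0 \<le> L\<close>])
    fix e :: real assume "0 < e"
    then have "\<forall>\<^sub>F k in sequentially. norm_sq (D k) < e / 4"
      by (intro order_tendstoD(2)[OF D_lim]) simp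
    then obtain N where N: "\<And>k. N \<le> k \<Longrightarrow> norm_sq (D k) < e / 4"
      by (auto simp: eventually_sequentially)
    have "norm_sq (\<lambda>x. f (r i) x - f (r j) x) \<le> e" if "N \<le> i" "N \<le> j" for i j
    proof -
      have "norm_sq (\<lambda>x. f (r i) x - f (r j) x) = norm_sq (fourier_integral (\<lambda>x. f (r i) x - f (r j) x))"
        by (rule plancherel(2)[OF L2_on_diff[OF fL fL] \<open>0 \<le> L\<close>, symmetric])
      also have "fourier_integral (\<lambda>x. f (r i) x - f (r j) x) = (\<lambda>\<xi>. D i \<xi> - D j \<xi>)"
        by (simp add: fun_eq_iff D_def fourier_integral_diff L2_on_integrable[OF fL])
      also have "norm_sq (\<lambda>\<xi>. D i \<xi> - D j \<xi>) \<le> 2 * norm_sq (D i) + 2 * norm_sq (D j)"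
        by (rule norm_sq_diff_le[OF D_sq D_sq])
      also have "\<dots> \<le> e" using N[OF that(1)] N[OF that(2)] by simp
      finally show ?thesis .
    qed
    then show "\<exists>N. \<forall>i\<ge>N. \<forall>j\<ge>N. norm_sq (\<lambda>x. f (r i) x - f (r j) x) \<le> e" by blast
  qed
  with r show ?thesis by blast
qed

lemma weighted_transform_lower_semicontinuous:
  assumes "0 \<le> L" and f: "\<And>k::nat. f k \<in> energy_space L \<alpha>" and u: "u \<in> L2_on L"
    and lim: "(\<lambda>k. norm_sq (\<lambda>x. f k x - u x)) \<longlonglongrightarrow> 0"
    and energy: "(\<lambda>k. norm_sq (weighted_transform \<alpha> (f k))) \<longlonglongrightarrow> m"
  shows "u \<in> energy_space L \<alpha>" "norm_sq (weighted_transform \<alpha> u) \<le> m"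
proof -
  have fL: "f k \<in> L2_on L" and fE: "square_integrable (weighted_transform \<alpha> (f k))" for k
    using f[of k] by (simp_all add: energy_space_def)
  note [measurable] = L2_on_measurable[OF u]
  have ptw: "(\<lambda>k. weighted_transform \<alpha> (f k) \<xi>) \<longlonglongrightarrow> weighted_transform \<alpha> u \<xi>" for \<xi>
    unfolding weighted_transform_def
    by (intro tendsto_intros fourier_integral_tendsto[OF fL u \<open>0 \<le> L\<close> lim])
  have *: "square_integrable (weighted_transform \<alpha> u)" "norm_sq (weighted_transform \<alpha> u) \<le> m + e" if "0 < e" for e
  proof -
    have "\<forall>\<^sub>F k in sequentially. norm_sq (weighted_transform \<alpha> (f k)) < m + e"
      using that by (intro order_tendstoD(2)[OF energy]) simp
    then have "\<forall>\<^sub>F k in sequentially. norm_sq (weighted_transform \<alpha> (f k)) \<le> m + e"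
      by eventually_elim simp
    then show "square_integrable (weighted_transform \<alpha> u)" "norm_sq (weighted_transform \<alpha> u) \<le> m + e"
      using norm_sq_fatou[of "weighted_transform \<alpha> u" "\<lambda>k. weighted_transform \<alpha> (f k)" "m + e"] fE ptw by simp_all
  qed
  show "u \<in> energy_space L \<alpha>" using u *(1)[of 1] by (simp add: energy_space_def)
  show "norm_sq (weighted_transform \<alpha> u) \<le> m" using *(2) by (rule field_le_epsilon)
qed

text \<open>
Hermitian symmetry, linearity and positivity are inherited from the inner product, because the weighted transform is
linear; the compactness assumption is \<open>rellich\<close> with lower semicontinuity.
\<close>

lemma energy_space_compact_form_pair:
  assumes "0 \<le> L" "0 < \<alpha>"
  shows "compact_form_pair (energy_space L \<alpha>) L2_inner
    (\<lambda>u v. L2_inner (weighted_transform \<alpha> u) (weighted_transform \<alpha> v))"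
proof
  let ?V = "energy_space L \<alpha>"
  have L: "u \<in> L2_on L" "square_integrable u" "square_integrable (weighted_transform \<alpha> u)" if "u \<in> ?V" for u
    using that by (auto simp: energy_space_def L2_on_def)
  have lin: "weighted_transform \<alpha> (\<lambda>x. u x + c * v x) = (\<lambda>\<xi>. weighted_transform \<alpha> u \<xi> + c * weighted_transform \<alpha> v \<xi>)"
    if "u \<in> ?V" "v \<in> ?V" for u v c
    using weighted_transform_lin L(1) that by blast
  have "weighted_transform \<alpha> (\<lambda>_. 0) = (\<lambda>_. 0)"
    by (simp add: weighted_transform_def fourier_integral_def fun_eq_iff)
  then show "(\<lambda>_. 0) \<in> ?V"
    by (simp add: energy_space_def L2_on_def square_integrable_def)
  show "(\<lambda>x. u x + c * v x) \<in> ?V" if "u \<in> ?V" "v \<in> ?V" for u v c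
    unfolding energy_space_def mem_Collect_eq lin[OF that]
    by (intro conjI L2_on_lin square_integrable_lin L that)
  show "L2_inner (\<lambda>x. u x + c * v x) w = L2_inner u w + c * L2_inner v w"
    if "u \<in> ?V" "v \<in> ?V" "w \<in> ?V" for u v w c
    by (intro L2.left_lin CollectI L that)
  show "L2_inner (weighted_transform \<alpha> (\<lambda>x. u x + c * v x)) (weighted_transform \<alpha> w)
      = L2_inner (weighted_transform \<alpha> u) (weighted_transform \<alpha> w) + c * L2_inner (weighted_transform \<alpha> v) (weighted_transform \<alpha> w)"
    if "u \<in> ?V" "v \<in> ?V" "w \<in> ?V" for u v w c
    unfolding lin[OF that(1,2)] by (intro L2.left_lin CollectI L that)
  show "L2_inner v u = cnj (L2_inner u v)" if "u \<in> ?V" "v \<in> ?V" for u v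
    by (intro L2.hermitian CollectI L that)
  show "L2_inner (weighted_transform \<alpha> v) (weighted_transform \<alpha> u) = cnj (L2_inner (weighted_transform \<alpha> u) (weighted_transform \<alpha> v))"
    if "u \<in> ?V" "v \<in> ?V" for u v
    by (intro L2.hermitian CollectI L that)
  show "0 \<le> Re (L2_inner u u)" for u
    by (simp add: L2_inner_self norm_sq_nonneg)
  show "0 \<le> Re (L2_inner (weighted_transform \<alpha> u) (weighted_transform \<alpha> u))" for u
    by (simp add: L2_inner_self norm_sq_nonneg)
  show "\<exists>u\<in>?V. \<exists>r::nat \<Rightarrow> nat. strict_mono r
      \<and> (\<lambda>k. Re (L2_inner (\<lambda>x. f (r k) x - u x) (\<lambda>x. f (r k) x - u x))) \<longlonglongrightarrow> 0
      \<and> Re (L2_inner (weighted_transform \<alpha> u) (weighted_transform \<alpha> u)) \<le> m"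
    if f: "\<And>k::nat. f k \<in> ?V" and f1: "\<And>k. Re (L2_inner (f k) (f k)) = 1"
      and energy: "(\<lambda>k. Re (L2_inner (weighted_transform \<alpha> (f k)) (weighted_transform \<alpha> (f k)))) \<longlonglongrightarrow> m" for f m
  proof -
    have f1': "norm_sq (f k) \<le> 1" for k using f1[of k] by (simp add: L2_inner_self)
    have energy': "(\<lambda>k. norm_sq (weighted_transform \<alpha> (f k))) \<longlonglongrightarrow> m" using energy by (simp add: L2_inner_self)
    obtain C where "\<And>k. norm (norm_sq (weighted_transform \<alpha> (f k))) \<le> C"
      using convergent_imp_Bseq[OF convergentI[OF energy']] by (auto simp: Bseq_def)
    then have C: "norm_sq (weighted_transform \<alpha> (f k)) \<le> C" for k
      using abs_ge_self order_trans unfolding real_norm_def by blast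
    obtain u r where u: "u \<in> L2_on L" and r: "strict_mono (r :: nat \<Rightarrow> nat)"
      and lim: "(\<lambda>k. norm_sq (\<lambda>x. f (r k) x - u x)) \<longlonglongrightarrow> 0"
      using rellich[of L \<alpha> f C, OF assms f f1' C] by (elim bexE exE conjE) (rule that)
    have "(\<lambda>k. norm_sq (weighted_transform \<alpha> (f (r k)))) \<longlonglongrightarrow> m"
      using LIMSEQ_subseq_LIMSEQ[OF energy' r] by (simp add: o_def)
    note weighted_transform_lower_semicontinuous[OF \<open>0 \<le> L\<close> f u lim this]
    with r lim show ?thesis
      unfolding L2_inner_self Re_complex_of_real by (intro bexI[of _ u] exI[of _ r] conjI)
  qed
qed

section \<open>Trial functions\<close>

text \<open>
For \<open>t = exp z\<close> the right-hand side minus the left-hand side is \<open>exp (a * z)\<close> times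
\<open>a * exp ((1 - a) * z) + (1 - a) * exp (- a * z) - 1\<close>, and the strict inequality \<open>1 + y < exp y\<close> makes the
latter positive: the first-order terms in \<open>z\<close> cancel.
\<close>

lemma powr_less_tangent:
  fixes t a :: real
  assumes "0 \<le> t" "t \<noteq> 1" "0 < a" "a < 1"
  shows "t powr a < a * t + (1 - a)"
proof (cases "t = 0")
  case False
  then have "0 < t" using assms by simp
  define z where "z = ln t"
  have "z \<noteq> 0" using \<open>0 < t\<close> assms(2) by (simp add: z_def)
  have exp_strict: "1 + y < exp y" if "y \<noteq> 0" for y :: real
  proof (rule ccontr)
    assume "\<not> 1 + y < exp y"
    then have "y = exp y - 1" using exp_ge_add_one_self[of y] by simp
    then have "ln (exp y) = exp y - 1" unfolding ln_exp .
    then have "exp y = 1" by (intro ln_eq_minus_one) auto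
    then show False using that by simp
  qed
  have "1 = a * (1 + (1 - a) * z) + (1 - a) * (1 + (- a * z))" by (simp add: algebra_simps)
  also have "\<dots> < a * exp ((1 - a) * z) + (1 - a) * exp (- a * z)"
    using assms \<open>z \<noteq> 0\<close> by (intro add_strict_mono mult_strict_left_mono exp_strict) auto
  finally have "exp (a * z) * 1 < exp (a * z) * (a * exp ((1 - a) * z) + (1 - a) * exp (- a * z))"
    by (intro mult_strict_left_mono) auto
  also have "\<dots> = a * exp (a * z + (1 - a) * z) + (1 - a) * exp (a * z + (- a * z))"
    by (simp only: exp_add) (simp add: algebra_simps)
  also have "\<dots> = a * exp z + (1 - a)" by (simp add: algebra_simps)
  finally show ?thesis using \<open>0 < t\<close> by (simp add: powr_def z_def)
qed (use assms in simp)

lemma symbol_less_tangent: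
  fixes \<xi> s \<alpha> :: real
  assumes "0 < s" "0 < \<alpha>" "\<alpha> < 2" "\<bar>\<xi>\<bar> \<noteq> s"
  shows "\<bar>\<xi>\<bar> powr \<alpha> < s powr \<alpha> * (\<alpha> / 2 * (\<xi>\<^sup>2 / s\<^sup>2) + (1 - \<alpha> / 2))"
proof -
  have "\<bar>\<xi>\<bar> / s \<noteq> 1" using assms by simp
  then have "(\<bar>\<xi>\<bar> / s)\<^sup>2 \<noteq> 1\<^sup>2" using assms(1) by (subst power2_eq_iff_nonneg) auto
  then have "((\<bar>\<xi>\<bar> / s)\<^sup>2) powr (\<alpha> / 2) < \<alpha> / 2 * (\<bar>\<xi>\<bar> / s)\<^sup>2 + (1 - \<alpha> / 2)"
    using assms by (intro powr_less_tangent) auto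
  moreover have "((\<bar>\<xi>\<bar> / s)\<^sup>2) powr (\<alpha> / 2) = (\<bar>\<xi>\<bar> / s) powr \<alpha>"
    using powr_powr[of "\<bar>\<xi>\<bar> / s" 2 "\<alpha> / 2"] assms(1) by simp
  moreover have "(\<bar>\<xi>\<bar> / s) powr \<alpha> = \<bar>\<xi>\<bar> powr \<alpha> / s powr \<alpha>"
    using assms(1) by (simp add: powr_divide)
  ultimately have "\<bar>\<xi>\<bar> powr \<alpha> / s powr \<alpha> < \<alpha> / 2 * (\<xi>\<^sup>2 / s\<^sup>2) + (1 - \<alpha> / 2)"
    by (simp only: power_divide power2_abs)
  then show ?thesis
    using pos_divide_less_eq[of "s powr \<alpha>" "\<bar>\<xi>\<bar> powr \<alpha>"] assms(1) by (simp only: powr_gt_zero mult.commute[of "s powr \<alpha>"])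
qed

definition cut_off :: "real \<Rightarrow> (real \<Rightarrow> complex) \<Rightarrow> real \<Rightarrow> complex" where
  "cut_off L h x = indicator {0..L} x *\<^sub>R h x"

lemma cut_off_in_L2_on:
  assumes "continuous_on {0..L} h"
  shows "cut_off L h \<in> L2_on L"
proof -
  have "cut_off L h \<in> borel_measurable borel"
    unfolding cut_off_def using assms by (intro borel_measurable_continuous_on_indicator) auto
  moreover have "integrable lborel (\<lambda>x. indicator {0..L} x *\<^sub>R (cmod (h x))\<^sup>2)"
    using assms by (intro borel_integrable_compact continuous_intros) auto
  then have "integrable lborel (\<lambda>x. (cmod (cut_off L h x))\<^sup>2)"
    by (rule back_subst[of "integrable lborel"]) (auto simp: cut_off_def fun_eq_iff split: split_indicator)
  moreover have "AE x in lborel. x \<notin> {0<..<L} \<longrightarrow> cut_off L h x = 0"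
    using AE_lborel_singleton[of 0] AE_lborel_singleton[of L]
    by eventually_elim (auto simp: cut_off_def)
  ultimately show ?thesis by (simp add: L2_on_def square_integrable_def)
qed

text \<open>
Integration by parts on the interval; the boundary terms vanish with \<open>h\<close>. The derivative may
jump at the end points when it is extended by zero.
\<close>

lemma fourier_integral_derivative:
  assumes "0 \<le> L" and h: "\<And>x. (h has_vector_derivative h' x) (at x)"
    and h': "continuous_on {0..L} h'" and "h 0 = 0" "h L = 0"
  shows "fourier_integral (cut_off L h') \<xi> = \<i> * complex_of_real \<xi> * fourier_integral (cut_off L h) \<xi>"
proof -
  let ?e = "\<lambda>x. exp (- (\<i> * complex_of_real (x * \<xi>)))"
  have hc: "continuous_on {0..L} h"
    using h by (intro continuous_at_imp_continuous_on ballI) (rule has_vector_derivative_continuous)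
  have e: "(?e has_vector_derivative - (\<i> * complex_of_real \<xi>) * ?e x) (at x within S)" for x S
  proof -
    have "((\<lambda>z. exp (- (\<i> * (z * complex_of_real \<xi>)))) has_field_derivative
        - (\<i> * complex_of_real \<xi>) * exp (- (\<i> * (complex_of_real x * complex_of_real \<xi>)))) (at (complex_of_real x))"
      by (auto intro!: derivative_eq_intros)
    from has_vector_derivative_real_field[OF this] show ?thesis by simp
  qed
  have "(LINT x|lborel. indicator {0..L} x *\<^sub>R (h x * (- (\<i> * complex_of_real \<xi>) * ?e x) + h' x * ?e x))
      = h L * ?e L - h 0 * ?e 0"
  proof (rule integral_FTC_Icc[OF \<open>0 \<le> L\<close>])
    show "((\<lambda>x. h x * ?e x) has_vector_derivative h x * (- (\<i> * complex_of_real \<xi>) * ?e x) + h' x * ?e x) (at x within {0..L})" for x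
      by (intro has_vector_derivative_mult e has_vector_derivative_at_within[OF h])
    show "continuous_on {0..L} (\<lambda>x. h x * (- (\<i> * complex_of_real \<xi>) * ?e x) + h' x * ?e x)"
      by (intro continuous_intros hc h')
  qed
  also have "\<dots> = 0" using assms by simp
  also have "(\<lambda>x. indicator {0..L} x *\<^sub>R (h x * (- (\<i> * complex_of_real \<xi>) * ?e x) + h' x * ?e x))
      = (\<lambda>x. cut_off L h' x * ?e x - \<i> * complex_of_real \<xi> * (cut_off L h x * ?e x))"
    by (auto simp: fun_eq_iff cut_off_def algebra_simps)
  finally have "(LINT x|lborel. cut_off L h' x * ?e x) - \<i> * complex_of_real \<xi> * (LINT x|lborel. cut_off L h x * ?e x) = 0"
    using integrable_kernel[OF L2_on_integrable[OF cut_off_in_L2_on[OF hc]], of \<xi>]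
      integrable_kernel[OF L2_on_integrable[OF cut_off_in_L2_on[OF h']], of \<xi>]
    by (simp del: of_real_mult)
  then show ?thesis by (simp add: fourier_integral_def del: of_real_mult)
qed

text \<open>
Here \<open>T s\<close> is the tangent bound of the symbol at frequency \<open>s\<close>. Its integral against the squared
transform is a combination of the squared norms of \<open>h\<close> and \<open>h'\<close>, so under the
assumption on their quotient it is at most \<open>s powr \<alpha>\<close> times that of \<open>h\<close>. The gap \<open>G\<close> has positive integral, for otherwise the transform would vanish
almost everywhere, against Plancherel's identity.
\<close>

lemma fractional_energy_less:
  assumes "0 \<le> L" "0 < \<alpha>" "\<alpha> < 2"
    and h: "\<And>x. (h has_vector_derivative h' x) (at x)"
    and h': "continuous_on {0..L} h'" and "h 0 = 0" "h L = 0"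
  shows "cut_off L h \<in> energy_space L \<alpha>"
    and "0 < s \<Longrightarrow> 0 < norm_sq (cut_off L h) \<Longrightarrow> norm_sq (cut_off L h') \<le> s\<^sup>2 * norm_sq (cut_off L h)
      \<Longrightarrow> norm_sq (weighted_transform \<alpha> (cut_off L h)) < s powr \<alpha> * norm_sq (cut_off L h)"
proof -
  define w where "w = cut_off L h"
  define w' where "w' = cut_off L h'"
  have hc: "continuous_on {0..L} h"
    using h by (intro continuous_at_imp_continuous_on ballI) (rule has_vector_derivative_continuous)
  have w: "w \<in> L2_on L" and w': "w' \<in> L2_on L"
    unfolding w_def w'_def using hc h' by (auto intro: cut_off_in_L2_on)
  note [measurable] = L2_on_measurable[OF w]
  have sq: "integrable lborel (\<lambda>\<xi>. (cmod (fourier_integral w \<xi>))\<^sup>2)"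
    using plancherel(1)[OF w \<open>0 \<le> L\<close>] by (simp add: square_integrable_def)
  have F': "(cmod (fourier_integral w' \<xi>))\<^sup>2 = \<xi>\<^sup>2 * (cmod (fourier_integral w \<xi>))\<^sup>2" for \<xi>
    unfolding w_def w'_def
    by (subst fourier_integral_derivative[OF \<open>0 \<le> L\<close> h h' \<open>h 0 = 0\<close> \<open>h L = 0\<close>])
      (simp add: norm_mult power_mult_distrib)
  have sq': "integrable lborel (\<lambda>\<xi>. \<xi>\<^sup>2 * (cmod (fourier_integral w \<xi>))\<^sup>2)"
    and norm_sq': "(LINT \<xi>|lborel. \<xi>\<^sup>2 * (cmod (fourier_integral w \<xi>))\<^sup>2) = norm_sq w'"
    using plancherel[OF w' \<open>0 \<le> L\<close>] by (simp_all add: square_integrable_def norm_sq_def F')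
  define T where "T s \<xi> = s powr \<alpha> * (\<alpha> / 2 * (\<xi>\<^sup>2 / s\<^sup>2) + (1 - \<alpha> / 2))" for s \<xi>
  have T_eq: "T s \<xi> * (cmod (fourier_integral w \<xi>))\<^sup>2
      = s powr \<alpha> * (\<alpha> / 2 / s\<^sup>2 * (\<xi>\<^sup>2 * (cmod (fourier_integral w \<xi>))\<^sup>2) + (1 - \<alpha> / 2) * (cmod (fourier_integral w \<xi>))\<^sup>2)" for s \<xi>
    by (simp add: T_def algebra_simps)
  have T_int: "integrable lborel (\<lambda>\<xi>. T s \<xi> * (cmod (fourier_integral w \<xi>))\<^sup>2)" for s
    unfolding T_eq by (intro integrable_mult_right Bochner_Integration.integrable_add sq sq')
  have T_val: "(LINT \<xi>|lborel. T s \<xi> * (cmod (fourier_integral w \<xi>))\<^sup>2)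
      = s powr \<alpha> * (\<alpha> / 2 / s\<^sup>2 * norm_sq w' + (1 - \<alpha> / 2) * norm_sq w)" for s
    unfolding T_eq using sq sq' plancherel(2)[OF w \<open>0 \<le> L\<close>] by (simp add: norm_sq' norm_sq_def[symmetric])
  have less: "\<bar>\<xi>\<bar> powr \<alpha> < T s \<xi>" if "0 < s" "\<bar>\<xi>\<bar> \<noteq> s" for s \<xi>
    unfolding T_def by (rule symbol_less_tangent[OF that(1) assms(2,3) that(2)])
  have ae_ne: "AE \<xi> in lborel. \<bar>\<xi>\<bar> \<noteq> s" for s :: real
    using AE_lborel_singleton[of s] AE_lborel_singleton[of "- s"] by eventually_elim (auto simp: abs_if)
  have energy: "integrable lborel (\<lambda>\<xi>. \<bar>\<xi>\<bar> powr \<alpha> * (cmod (fourier_integral w \<xi>))\<^sup>2)"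
  proof (rule Bochner_Integration.integrable_bound[OF T_int[of 1]])
    show "AE \<xi> in lborel. norm (\<bar>\<xi>\<bar> powr \<alpha> * (cmod (fourier_integral w \<xi>))\<^sup>2) \<le> norm (T 1 \<xi> * (cmod (fourier_integral w \<xi>))\<^sup>2)"
      using ae_ne[of 1]
    proof eventually_elim
      fix \<xi> :: real assume "\<bar>\<xi>\<bar> \<noteq> 1"
      then have "\<bar>\<xi>\<bar> powr \<alpha> < T 1 \<xi>" by (intro less) auto
      then have "\<bar>\<xi>\<bar> powr \<alpha> \<le> \<bar>T 1 \<xi>\<bar>" by linarith
      then show "norm (\<bar>\<xi>\<bar> powr \<alpha> * (cmod (fourier_integral w \<xi>))\<^sup>2) \<le> norm (T 1 \<xi> * (cmod (fourier_integral w \<xi>))\<^sup>2)"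
        by (simp add: abs_mult mult_right_mono)
    qed
  qed measurable
  show "cut_off L h \<in> energy_space L \<alpha>"
    using w energy by (simp add: energy_space_def square_integrable_def weighted_transform_square w_def[symmetric])
  show "norm_sq (weighted_transform \<alpha> (cut_off L h)) < s powr \<alpha> * norm_sq (cut_off L h)"
    if s: "0 < s" and pos: "0 < norm_sq (cut_off L h)" and le: "norm_sq (cut_off L h') \<le> s\<^sup>2 * norm_sq (cut_off L h)"
  proof -
    define G where "G \<xi> = T s \<xi> * (cmod (fourier_integral w \<xi>))\<^sup>2 - \<bar>\<xi>\<bar> powr \<alpha> * (cmod (fourier_integral w \<xi>))\<^sup>2" for \<xi>
    have G_int: "integrable lborel G"
      unfolding G_def by (intro Bochner_Integration.integrable_diff T_int energy)
    have G_nonneg: "AE \<xi> in lborel. 0 \<le> G \<xi>"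
      using ae_ne[of s] by eventually_elim (auto simp: G_def intro!: mult_right_mono dest!: less[OF s])
    have "integral\<^sup>L lborel G \<noteq> 0"
    proof
      assume "integral\<^sup>L lborel G = 0"
      then have "AE \<xi> in lborel. G \<xi> = 0"
        using integral_nonneg_eq_0_iff_AE[OF G_int G_nonneg] by simp
      then have "AE \<xi> in lborel. (cmod (fourier_integral w \<xi>))\<^sup>2 = 0"
        using ae_ne[of s]
      proof eventually_elim
        fix \<xi> assume "G \<xi> = 0" "\<bar>\<xi>\<bar> \<noteq> s"
        then have "(T s \<xi> - \<bar>\<xi>\<bar> powr \<alpha>) * (cmod (fourier_integral w \<xi>))\<^sup>2 = 0"
          by (simp add: G_def algebra_simps)
        then show "(cmod (fourier_integral w \<xi>))\<^sup>2 = 0"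
          using less[OF s \<open>\<bar>\<xi>\<bar> \<noteq> s\<close>] by simp
      qed
      then have "norm_sq (fourier_integral w) = 0"
        unfolding norm_sq_def by (rule integral_eq_zero_AE)
      then show False using pos plancherel(2)[OF w \<open>0 \<le> L\<close>] by (simp add: w_def)
    qed
    then have "0 < integral\<^sup>L lborel G"
      using integral_nonneg_AE[OF G_nonneg] by simp
    also have "integral\<^sup>L lborel G
        = s powr \<alpha> * (\<alpha> / 2 / s\<^sup>2 * norm_sq w' + (1 - \<alpha> / 2) * norm_sq w) - norm_sq (weighted_transform \<alpha> w)"
      unfolding G_def using T_int energy by (simp add: T_val norm_sq_def weighted_transform_square)
    also have "\<dots> \<le> s powr \<alpha> * (\<alpha> / 2 / s\<^sup>2 * (s\<^sup>2 * norm_sq w) + (1 - \<alpha> / 2) * norm_sq w) - norm_sq (weighted_transform \<alpha> w)"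
      using le assms(2) by (intro diff_right_mono mult_left_mono add_right_mono) (auto simp: w_def w'_def)
    also have "\<dots> = s powr \<alpha> * norm_sq w - norm_sq (weighted_transform \<alpha> w)"
      using s by (simp add: algebra_simps)
    finally show ?thesis by (simp add: w_def)
  qed
qed

lemma integral_cos_interval:
  fixes m :: int
  assumes "0 < L"
  shows "has_bochner_integral lborel (\<lambda>x. indicator {0..L} x *\<^sub>R cos (of_int m * pi * x / L)) (if m = 0 then L else 0)"
proof (cases "m = 0")
  case True
  then show ?thesis
    using has_bochner_integral_FTC_Icc[of 0 L "\<lambda>x. x" "\<lambda>x. 1 :: real"] assms
    by (simp add: has_vector_derivative_id)
next
  case False
  define k where "k = of_int m * pi / L"
  have k: "k \<noteq> 0" using False assms by (simp add: k_def)
  have "has_bochner_integral lborel (\<lambda>x. indicator {0..L} x *\<^sub>R cos (k * x)) (sin (k * L) / k - sin (k * 0) / k)"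
  proof (rule has_bochner_integral_FTC_Icc)
    show "((\<lambda>x. sin (k * x) / k) has_vector_derivative cos (k * x)) (at x within {0..L})" for x
      unfolding has_real_derivative_iff_has_vector_derivative[symmetric]
      using k by (auto intro!: derivative_eq_intros)
  qed (use assms in \<open>auto intro!: continuous_intros\<close>)
  moreover have "sin (k * L) = 0" using assms by (simp add: k_def sin_zero_iff_int2)
  ultimately show ?thesis using False by (simp add: k_def)
qed

lemma L2_inner_cut_off:
  "L2_inner (cut_off L (\<lambda>x. complex_of_real (f x))) (cut_off L (\<lambda>x. complex_of_real (g x)))
    = complex_of_real (LINT x|lborel. indicator {0..L} x *\<^sub>R (f x * g x))"
proof -
  have "(\<lambda>x. cut_off L (\<lambda>x. complex_of_real (f x)) x * cnj (cut_off L (\<lambda>x. complex_of_real (g x)) x))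
      = (\<lambda>x. complex_of_real (indicator {0..L} x *\<^sub>R (f x * g x)))"
    by (auto simp: cut_off_def fun_eq_iff split: split_indicator)
  then show ?thesis by (simp only: L2_inner_def integral_complex_of_real)
qed

definition frequency :: "real \<Rightarrow> nat \<Rightarrow> real" where
  "frequency L i = real (Suc i) * pi / L"

lemma sine_orthogonality:
  assumes "0 < L"
  shows "L2_inner (cut_off L (\<lambda>x. complex_of_real (sin (frequency L i * x))))
        (cut_off L (\<lambda>x. complex_of_real (sin (frequency L j * x))))
      = (if i = j then complex_of_real (L / 2) else 0)" (is ?sin)
    and "L2_inner (cut_off L (\<lambda>x. complex_of_real (frequency L i * cos (frequency L i * x))))
        (cut_off L (\<lambda>x. complex_of_real (frequency L j * cos (frequency L j * x))))
      = (if i = j then complex_of_real ((frequency L i)\<^sup>2 * (L / 2)) else 0)" (is ?cos)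
proof -
  define a b where "a = int i - int j" and "b = int i + int j + 2"
  note C = integral_cos_interval[OF assms, of a] integral_cos_interval[OF assms, of b]
  have ab: "a = 0 \<longleftrightarrow> i = j" "b \<noteq> 0" by (auto simp: a_def b_def)
  have diff: "frequency L i * x - frequency L j * x = of_int a * pi * x / L"
    and add: "frequency L i * x + frequency L j * x = of_int b * pi * x / L" for x
    using assms by (simp_all add: frequency_def a_def b_def field_simps)
  have sin_eq: "(\<lambda>x. indicator {0..L} x *\<^sub>R (sin (frequency L i * x) * sin (frequency L j * x)))
      = (\<lambda>x. 1 / 2 * (indicator {0..L} x *\<^sub>R cos (of_int a * pi * x / L) - indicator {0..L} x *\<^sub>R cos (of_int b * pi * x / L)))"
    unfolding sin_times_sin diff add by (simp add: fun_eq_iff right_diff_distrib)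
  have "has_bochner_integral lborel (\<lambda>x. indicator {0..L} x *\<^sub>R (sin (frequency L i * x) * sin (frequency L j * x)))
      (1 / 2 * ((if a = 0 then L else 0) - (if b = 0 then L else 0)))"
    unfolding sin_eq by (intro has_bochner_integral_mult_right has_bochner_integral_diff C)
  then show ?sin
    unfolding L2_inner_cut_off by (simp add: has_bochner_integral_integral_eq ab)
  have cos_eq: "(\<lambda>x. indicator {0..L} x *\<^sub>R ((frequency L i * cos (frequency L i * x)) * (frequency L j * cos (frequency L j * x))))
      = (\<lambda>x. frequency L i * frequency L j / 2 *
          (indicator {0..L} x *\<^sub>R cos (of_int a * pi * x / L) + indicator {0..L} x *\<^sub>R cos (of_int b * pi * x / L)))"
  proof
    fix x
    have "(frequency L i * cos (frequency L i * x)) * (frequency L j * cos (frequency L j * x))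
        = frequency L i * frequency L j * (cos (frequency L i * x) * cos (frequency L j * x))"
      by (simp only: mult_ac)
    also have "\<dots> = frequency L i * frequency L j / 2 * (cos (of_int a * pi * x / L) + cos (of_int b * pi * x / L))"
      unfolding cos_times_cos diff add by simp
    finally show "indicator {0..L} x *\<^sub>R ((frequency L i * cos (frequency L i * x)) * (frequency L j * cos (frequency L j * x)))
      = frequency L i * frequency L j / 2 *
          (indicator {0..L} x *\<^sub>R cos (of_int a * pi * x / L) + indicator {0..L} x *\<^sub>R cos (of_int b * pi * x / L))"
      by (simp split: split_indicator)
  qed
  have "has_bochner_integral lborel (\<lambda>x. indicator {0..L} x *\<^sub>R ((frequency L i * cos (frequency L i * x)) * (frequency L j * cos (frequency L j * x))))
      (frequency L i * frequency L j / 2 * ((if a = 0 then L else 0) + (if b = 0 then L else 0)))"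
    unfolding cos_eq by (intro has_bochner_integral_mult_right has_bochner_integral_add C)
  then show ?cos
    unfolding L2_inner_cut_off by (simp add: has_bochner_integral_integral_eq ab power2_eq_square)
qed

text \<open>
Both the sines and their derivatives are orthogonal on the interval. Hence both squared norms are
diagonal in the coefficients, and the largest frequency \<open>n * pi / L\<close> controls their quotient.
\<close>

lemma sine_combination_energy:
  assumes "0 < L" "0 < \<alpha>" "\<alpha> < 2"
    and w: "w = (\<lambda>x. \<Sum>i<n. c i * cut_off L (\<lambda>x. complex_of_real (sin (frequency L i * x))) x)"
  shows "w \<in> energy_space L \<alpha>"
    and "\<exists>i<n. c i \<noteq> 0 \<Longrightarrow> norm_sq (weighted_transform \<alpha> w) < (real n * pi / L) powr \<alpha> * norm_sq w"
proof -
  define S where "S i = cut_off L (\<lambda>x. complex_of_real (sin (frequency L i * x)))" for i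
  define C where "C i = cut_off L (\<lambda>x. complex_of_real (frequency L i * cos (frequency L i * x)))" for i
  define h where "h x = (\<Sum>i<n. c i * complex_of_real (sin (frequency L i * x)))" for x
  define h' where "h' x = (\<Sum>i<n. c i * complex_of_real (frequency L i * cos (frequency L i * x)))" for x
  have w_eq: "w = cut_off L h"
    by (simp add: w h_def cut_off_def fun_eq_iff scaleR_sum_right)
  have w'_eq: "cut_off L h' = (\<lambda>x. \<Sum>i<n. c i * C i x)"
    by (simp add: C_def h'_def cut_off_def fun_eq_iff scaleR_sum_right)
  have h: "(h has_vector_derivative h' x) (at x)" for x
  proof -
    have "((\<lambda>x. complex_of_real (sin (k * x))) has_vector_derivative complex_of_real (k * cos (k * x))) (at x)" for k
      by (rule has_vector_derivative_of_real) (auto intro!: derivative_eq_intros)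
    then show ?thesis
      unfolding h_def h'_def
      by (intro has_vector_derivative_sum bounded_linear.has_vector_derivative[OF bounded_linear_mult_right])
  qed
  have h': "continuous_on {0..L} h'" unfolding h'_def by (intro continuous_intros)
  have h0: "h 0 = 0" "h L = 0"
    using \<open>0 < L\<close> by (simp_all add: h_def frequency_def sin_times_pi_eq_0 del: of_nat_Suc)
  note energy = fractional_energy_less[OF less_imp_le[OF \<open>0 < L\<close>] assms(2,3) h h' h0]
  show "w \<in> energy_space L \<alpha>" unfolding w_eq by (rule energy(1))
  show "norm_sq (weighted_transform \<alpha> w) < (real n * pi / L) powr \<alpha> * norm_sq w" if c: "\<exists>i<n. c i \<noteq> 0"
  proof -
    have S: "S i \<in> Collect square_integrable" and C: "C i \<in> Collect square_integrable" for i
      unfolding S_def C_def by (auto intro!: L2_on_square_integrable cut_off_in_L2_on continuous_intros)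
    have norm_sq_w: "norm_sq w = (\<Sum>i<n. (cmod (c i))\<^sup>2 * (L / 2))"
      using L2.diagonal_orthogonal_sum[of n S "\<lambda>_. L / 2" c] S sine_orthogonality(1)[OF \<open>0 < L\<close>]
      by (simp add: S_def w L2_inner_self)
    have norm_sq_w': "norm_sq (cut_off L h') = (\<Sum>i<n. (cmod (c i))\<^sup>2 * ((frequency L i)\<^sup>2 * (L / 2)))"
      using L2.diagonal_orthogonal_sum[of n C "\<lambda>i. (frequency L i)\<^sup>2 * (L / 2)" c] C sine_orthogonality(2)[OF \<open>0 < L\<close>]
      unfolding w'_eq by (simp add: C_def L2_inner_self)
    from c obtain k where k: "k < n" "c k \<noteq> 0" by blast
    have "0 < (cmod (c k))\<^sup>2 * (L / 2)" using k \<open>0 < L\<close> by simp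
    also have "\<dots> \<le> norm_sq w"
      unfolding norm_sq_w using k \<open>0 < L\<close> by (intro member_le_sum) auto
    finally have pos: "0 < norm_sq w" .
    have "norm_sq (cut_off L h') \<le> (\<Sum>i<n. (real n * pi / L)\<^sup>2 * ((cmod (c i))\<^sup>2 * (L / 2)))"
      unfolding norm_sq_w'
    proof (rule sum_mono)
      fix i assume "i \<in> {..<n}"
      then have "(frequency L i)\<^sup>2 \<le> (real n * pi / L)\<^sup>2"
        unfolding frequency_def using \<open>0 < L\<close> by (intro power_mono divide_right_mono mult_right_mono) auto
      then have "(frequency L i)\<^sup>2 * ((cmod (c i))\<^sup>2 * (L / 2)) \<le> (real n * pi / L)\<^sup>2 * ((cmod (c i))\<^sup>2 * (L / 2))"
        using \<open>0 < L\<close> by (intro mult_right_mono) auto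
      then show "(cmod (c i))\<^sup>2 * ((frequency L i)\<^sup>2 * (L / 2)) \<le> (real n * pi / L)\<^sup>2 * ((cmod (c i))\<^sup>2 * (L / 2))"
        by (simp only: mult.left_commute)
    qed
    also have "\<dots> = (real n * pi / L)\<^sup>2 * norm_sq w"
      by (simp only: norm_sq_w sum_distrib_left)
    finally have le: "norm_sq (cut_off L h') \<le> (real n * pi / L)\<^sup>2 * norm_sq w" .
    have "0 < real n * pi / L" using k \<open>0 < L\<close> by simp
    from energy(2)[OF this pos[unfolded w_eq] le[unfolded w_eq]] show ?thesis unfolding w_eq .
  qed
qed

section \<open>The eigenvalue bound\<close>

text \<open>
Without a lower bound the infimum in the definition of the eigenvalue would be unspecified. Testing the
weak equation with the eigenfunction itself shows that an eigenvalue is a quotient of energy and squared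
norm.
\<close>

lemma eigenvalue_count_bounded_below:
  assumes "0 < L" "0 < \<alpha>" "1 \<le> n" "eigenvalue_count_ge {0<..<L} \<alpha> n t"
  shows "0 \<le> t"
proof -
  from assms(4) obtain \<mu> u where *: "\<forall>i<n. weak_eigenfunction {0<..<L} \<alpha> (\<mu> i) (u i) \<and> \<mu> i \<le> t"
    unfolding eigenvalue_count_ge_def by blast
  have "weak_eigenfunction {0<..<L} \<alpha> (\<mu> 0) (u 0)" "\<mu> 0 \<le> t" using * assms(3) by auto
  then have u: "u 0 \<in> energy_space L \<alpha>" and nz: "\<not> (AE x in lborel. u 0 x = 0)"
    and eig: "frac_form \<alpha> (u 0) (u 0) = complex_of_real (\<mu> 0) * L2_inner (u 0) (u 0)"
    by (auto simp: weak_eigenfunction_def sobolev0_eq_energy_space[OF assms(1,2)])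
  have uL: "u 0 \<in> L2_on L" using u by (simp add: energy_space_def)
  have "complex_of_real (norm_sq (weighted_transform \<alpha> (u 0))) = complex_of_real (\<mu> 0 * norm_sq (u 0))"
    using eig frac_form_eq[OF uL uL, of \<alpha>] assms(1) by (simp add: L2_inner_self)
  then have eq: "norm_sq (weighted_transform \<alpha> (u 0)) = \<mu> 0 * norm_sq (u 0)" by (simp only: of_real_eq_iff)
  have "norm_sq (u 0) \<noteq> 0"
  proof
    assume "norm_sq (u 0) = 0"
    then have "AE x in lborel. (cmod (u 0 x))\<^sup>2 = 0"
      using L2_on_square_integrable[OF uL] unfolding norm_sq_def square_integrable_def
      by (subst (asm) integral_nonneg_eq_0_iff_AE) auto
    then have "AE x in lborel. u 0 x = 0" by eventually_elim simp
    with nz show False by blast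
  qed
  then have "0 < norm_sq (u 0)" using norm_sq_nonneg[of "u 0"] by simp
  moreover have "0 \<le> \<mu> 0 * norm_sq (u 0)" using norm_sq_nonneg[of "weighted_transform \<alpha> (u 0)"] eq by simp
  ultimately have "0 \<le> \<mu> 0" by (simp add: zero_le_mult_iff)
  with \<open>\<mu> 0 \<le> t\<close> show ?thesis by simp
qed

lemma orthonormal_AE_independent:
  assumes sq: "\<And>i. i < n \<Longrightarrow> square_integrable (u i)"
    and orth: "\<And>i j. i < n \<Longrightarrow> j < n \<Longrightarrow> L2_inner (u i) (u j) = (if i = j then 1 else 0)"
  shows "AE_independent n u"
  unfolding AE_independent_def
proof (intro allI impI)
  fix c :: "nat \<Rightarrow> complex" and i
  assume ae: "AE x in lborel. (\<Sum>i<n. c i * u i x) = 0" and i: "i < n"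
  have "L2_inner (\<lambda>x. \<Sum>j<n. c j * u j x) (u i) = (\<Sum>j<n. c j * L2_inner (u j) (u i))"
    using sq i by (intro L2.sum_left) auto
  also have "\<dots> = (\<Sum>j<n. if j = i then c j else 0)"
    using orth i by (intro sum.cong) auto
  also have "\<dots> = c i" using i by simp
  finally have "c i = L2_inner (\<lambda>x. \<Sum>j<n. c j * u j x) (u i)" by simp
  also have "\<dots> = 0"
    unfolding L2_inner_def by (rule integral_eq_zero_AE) (use ae in \<open>eventually_elim, simp\<close>)
  finally show "c i = 0" .
qed

theorem theorem1:
  fixes L \<alpha> :: real and n :: nat
  assumes "0 < L" and "0 < \<alpha>" and "\<alpha> < 2" and "1 \<le> n"
  shows "frac_eigenvalue {0<..<L} \<alpha> n < (real n * pi / L) powr \<alpha>"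
proof -
  have L: "0 \<le> L" using assms(1) by simp
  let ?b = "(real n * pi / L) powr \<alpha>"
  let ?s = "\<lambda>i. cut_off L (\<lambda>x. complex_of_real (sin (frequency L i * x)))"
  interpret P: compact_form_pair "energy_space L \<alpha>" L2_inner
    "\<lambda>u v. L2_inner (weighted_transform \<alpha> u) (weighted_transform \<alpha> v)"
    by (rule energy_space_compact_form_pair[OF L assms(2)])
  \<comment> \<open>A single sine is the combination with one coefficient equal to 1.\<close>
  have single: "?s i \<in> energy_space L \<alpha>" for i
  proof (rule sine_combination_energy(1)[OF assms(1-3)])
    show "?s i = (\<lambda>x. \<Sum>j<Suc i. (if j = i then 1 else 0) * ?s j x)" by (simp add: fun_eq_iff)
  qed
  obtain e \<mu> where e: "\<forall>i<n. e i \<in> energy_space L \<alpha>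
      \<and> (\<forall>v\<in>energy_space L \<alpha>. L2_inner (weighted_transform \<alpha> (e i)) (weighted_transform \<alpha> v) = of_real (\<mu> i) * L2_inner (e i) v)
      \<and> \<mu> i < ?b"
    and orth: "\<forall>i<n. \<forall>j<n. L2_inner (e i) (e j) = (if i = j then 1 else 0)"
  proof -
    have "\<exists>e \<mu>. (\<forall>i<n. e i \<in> energy_space L \<alpha>
      \<and> (\<forall>v\<in>energy_space L \<alpha>. L2_inner (weighted_transform \<alpha> (e i)) (weighted_transform \<alpha> v) = of_real (\<mu> i) * L2_inner (e i) v)
      \<and> \<mu> i < ?b) \<and> (\<forall>i<n. \<forall>j<n. L2_inner (e i) (e j) = (if i = j then 1 else 0))"
    proof (rule P.eigenvectors_below[where w = ?s, OF single _ order_refl])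
      fix c :: "nat \<Rightarrow> complex" assume "\<exists>i<n. c i \<noteq> 0"
      then show "Re (L2_inner (weighted_transform \<alpha> (\<lambda>x. \<Sum>i<n. c i * ?s i x)) (weighted_transform \<alpha> (\<lambda>x. \<Sum>i<n. c i * ?s i x)))
          < ?b * Re (L2_inner (\<lambda>x. \<Sum>i<n. c i * ?s i x) (\<lambda>x. \<Sum>i<n. c i * ?s i x))"
        unfolding L2_inner_self Re_complex_of_real by (rule sine_combination_energy(2)[OF assms(1-3) refl])
    qed
    then show ?thesis by (elim exE conjE) (rule that)
  qed
  define t where "t = Max (\<mu> ` {..<n})"
  have ne: "\<mu> ` {..<n} \<noteq> {}" using assms(4) by (auto simp: lessThan_empty_iff)
  have "t < ?b" unfolding t_def using e ne by (subst Max_less_iff) auto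
  have "weak_eigenfunction {0<..<L} \<alpha> (\<mu> i) (e i)" if i: "i < n" for i
    unfolding weak_eigenfunction_def sobolev0_eq_energy_space[OF assms(1,2)]
  proof (intro conjI ballI notI)
    show ei: "e i \<in> energy_space L \<alpha>" using e i by blast
    show False if "AE x in lborel. e i x = 0"
    proof -
      have "L2_inner (e i) (e i) = 0"
        unfolding L2_inner_def by (rule integral_eq_zero_AE) (use that in \<open>eventually_elim, simp\<close>)
      then show False using orth i by simp
    qed
    show "frac_form \<alpha> (e i) v = complex_of_real (\<mu> i) * L2_inner (e i) v" if v: "v \<in> energy_space L \<alpha>" for v
      using frac_form_eq[of "e i" L v \<alpha>] L ei v e i by (simp add: energy_space_def)
  qed
  moreover have "\<mu> i \<le> t" if "i < n" for i unfolding t_def using that by (intro Max_ge) auto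
  moreover have "AE_independent n e"
    using e orth by (intro orthonormal_AE_independent) (auto simp: energy_space_def L2_on_def)
  ultimately have "eigenvalue_count_ge {0<..<L} \<alpha> n t"
    unfolding eigenvalue_count_ge_def by blast
  then have "frac_eigenvalue {0<..<L} \<alpha> n \<le> t"
    unfolding frac_eigenvalue_def
    using eigenvalue_count_bounded_below[OF assms(1,2,4)] by (intro cInf_lower bdd_belowI[of _ 0]) auto
  with \<open>t < ?b\<close> show ?thesis by simp
qed

end
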